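(* Let $n=2$ and let $\mathbb L_0$ be the operator on $[a,b]$ generated by $\ell_0=-D^2$ and by normalized Birkhoff regular boundary conditions $(P_j(D)y)(a)+(Q_j(D)y)(b)=0$, $j=0,1$. Let $\lambda_N^0$ be its eigenvalues and $G_0(x,y,\lambda)$ its Green function (the integral kernel of $(\mathbb L_0-\lambda)^{-1}$). Let $x\in[a,b]$, $x\ne a,b$. Then for every sequence $R=R_\ell\to\infty$ separated from $\{|\lambda_N^0|^{1/2}\}_{N\ge1}$, $$\lim_{R\to\infty}\int_{|\lambda|=R^2}G_0(x,x,\lambda)^2\,d\lambda=-\frac{\pi i}2.$$
   Context: $D=d/dx$. $P_j,Q_j$ ($j=0,1$) are polynomials with complex coefficients of degree at most $1$; $d_j$ is the maximum of the degrees of $P_j$ and $Q_j$; $a_j$ and $b_j$ are the coefficients of the $d_j$-th power in $P_j$ and $Q_j$ respectively (not both zero). The system of boundary conditions is normalized: $d_0+d_1$ is minimal among all systems of boundary conditions obtained from it by invertible linear transformations. Birkhoff regularity for $n=2$: writing $$\det\begin{pmatrix}a_0+sb_0 & (-1)^{d_0}(a_0+b_0/s)\\ a_1+sb_1& (-1)^{d_1}(a_1+b_1/s)\end{pmatrix}=\theta_1s+\theta_0+\theta_{-1}s^{-1},$$ the boundary conditions are regular if $\theta_1\ne0$ and $\theta_{-1}\neq0$. $\mathbb L_0$ acts in $L_2(a,b)$ on functions $y$ with $y,y'$ absolutely continuous, $y''\in L_2(a,b)$, satisfying the boundary conditions; it is not assumed self-adjoint and has purely discrete spectrum. A sequence $R_\ell\to\infty$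 is separated from $\{|\lambda_N^0|^{1/2}\}$ if there is $\delta>0$ with $\big|R_\ell-|\lambda_N^0|^{1/2}\big|\ge\delta$ for all $\ell,N$. Circles are traversed counterclockwise. *)

theory Defs
  imports "HOL-Complex_Analysis.Complex_Analysis" "HOL-Computational_Algebra.Polynomial"
begin

text \<open>
  Boundary conditions \<open>(P\<^sub>j(D) y)(a) + (Q\<^sub>j(D) y)(b) = 0\<close>, \<open>j = 0, 1\<close>, are given by
  \<open>P Q :: 2 \<Rightarrow> complex poly\<close>; the two elements of the index type \<open>2\<close> are \<open>0\<close> and \<open>1\<close>.
\<close>

definition bc_order :: "(2 \<Rightarrow> complex poly) \<Rightarrow> (2 \<Rightarrow> complex poly) \<Rightarrow> 2 \<Rightarrow> nat" where
  "bc_order P Q j = max (degree (P j)) (degree (Q j))"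

definition lead_a :: "(2 \<Rightarrow> complex poly) \<Rightarrow> (2 \<Rightarrow> complex poly) \<Rightarrow> 2 \<Rightarrow> complex" where
  "lead_a P Q j = coeff (P j) (bc_order P Q j)"

definition lead_b :: "(2 \<Rightarrow> complex poly) \<Rightarrow> (2 \<Rightarrow> complex poly) \<Rightarrow> 2 \<Rightarrow> complex" where
  "lead_b P Q j = coeff (Q j) (bc_order P Q j)"

definition transform_bc :: "complex^2^2 \<Rightarrow> (2 \<Rightarrow> complex poly) \<Rightarrow> 2 \<Rightarrow> complex poly" where
  "transform_bc M P = (\<lambda>j. \<Sum>k\<in>UNIV. smult (M $ j $ k) (P k))"

definition normalized_bc :: "(2 \<Rightarrow> complex poly) \<Rightarrow> (2 \<Rightarrow> complex poly) \<Rightarrow> bool" where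
  "normalized_bc P Q \<longleftrightarrow>
     (\<forall>M :: complex^2^2. invertible M \<longrightarrow>
        bc_order P Q 0 + bc_order P Q 1
          \<le> bc_order (transform_bc M P) (transform_bc M Q) 0
            + bc_order (transform_bc M P) (transform_bc M Q) 1)"

definition birkhoff_regular :: "(2 \<Rightarrow> complex poly) \<Rightarrow> (2 \<Rightarrow> complex poly) \<Rightarrow> bool" where
  "birkhoff_regular P Q \<longleftrightarrow>
     (\<exists>\<theta>\<^sub>1 \<theta>\<^sub>0 \<theta>\<^sub>m :: complex.
        (\<forall>s. s \<noteq> 0 \<longrightarrow>
           det (vector
             [vector [lead_a P Q 0 + s * lead_b P Q 0,
                      (-1) ^ bc_order P Q 0 * (lead_a P Q 0 + lead_b P Q 0 / s)],
              vector [lead_a P Q 1 + s * lead_b P Q 1,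
                      (-1) ^ bc_order P Q 1 * (lead_a P Q 1 + lead_b P Q 1 / s)]]
             :: complex^2^2)
           = \<theta>\<^sub>1 * s + \<theta>\<^sub>0 + \<theta>\<^sub>m / s)
        \<and> \<theta>\<^sub>1 \<noteq> 0 \<and> \<theta>\<^sub>m \<noteq> 0)"

text \<open>
  Functions on \<open>[a,b]\<close> are represented by total functions \<open>real \<Rightarrow> complex\<close> of which only the
  values on \<open>{a..b}\<close> matter; derivatives are taken within \<open>{a..b}\<close>, hence one-sided at \<open>a\<close>
  and \<open>b\<close>.
\<close>

definition D_on :: "real \<Rightarrow> real \<Rightarrow> (real \<Rightarrow> complex) \<Rightarrow> real \<Rightarrow> complex" where
  "D_on a b y = (\<lambda>t. vector_derivative y (at t within {a..b}))"

definition poly_D :: "real \<Rightarrow> real \<Rightarrow> complex poly \<Rightarrow> (real \<Rightarrow> complex) \<Rightarrow> real \<Rightarrow> complex" where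
  "poly_D a b p y t = (\<Sum>i\<le>degree p. coeff p i * (D_on a b ^^ i) y t)"

text \<open>A pair \<open>(l, r)\<close> in \<open>S\<close> stands for the interval with endpoints \<open>l \<le> r\<close>.\<close>

definition abs_cont_on :: "real \<Rightarrow> real \<Rightarrow> (real \<Rightarrow> complex) \<Rightarrow> bool" where
  "abs_cont_on a b f \<longleftrightarrow>
     (\<forall>\<epsilon>>0. \<exists>\<delta>>0. \<forall>S :: (real \<times> real) set.
        finite S \<and> (\<forall>(l, r)\<in>S. a \<le> l \<and> l \<le> r \<and> r \<le> b)
        \<and> disjoint_family_on (\<lambda>(l, r). {l<..<r}) S
        \<and> (\<Sum>(l, r)\<in>S. r - l) < \<delta>
        \<longrightarrow> (\<Sum>(l, r)\<in>S. norm (f r - f l)) < \<epsilon>)"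

definition in_L2 :: "real \<Rightarrow> real \<Rightarrow> (real \<Rightarrow> complex) \<Rightarrow> bool" where
  "in_L2 a b f \<longleftrightarrow>
     f \<in> borel_measurable (lebesgue_on {a..b})
     \<and> integrable (lebesgue_on {a..b}) (\<lambda>t. (norm (f t))\<^sup>2)"

text \<open>
  The almost everywhere differentiability of \<open>y'\<close> is automatic for an absolutely continuous
  \<open>y'\<close>. It is spelled out because \<open>vector_derivative\<close> is a total function, so that
  \<open>y'' \<in> L\<^sub>2\<close> alone does not express that \<open>y''\<close> exists.
\<close>

definition L0_dom ::
  "real \<Rightarrow> real \<Rightarrow> (2 \<Rightarrow> complex poly) \<Rightarrow> (2 \<Rightarrow> complex poly) \<Rightarrow> (real \<Rightarrow> complex) set" where
  "L0_dom a b P Q = {y.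
     (\<forall>t\<in>{a..b}. y differentiable (at t within {a..b}))
     \<and> abs_cont_on a b y
     \<and> abs_cont_on a b (D_on a b y)
     \<and> (AE t in lebesgue_on {a..b}. D_on a b y differentiable (at t within {a..b}))
     \<and> in_L2 a b ((D_on a b ^^ 2) y)
     \<and> (\<forall>j. poly_D a b (P j) y a + poly_D a b (Q j) y b = 0)}"

definition L0 :: "real \<Rightarrow> real \<Rightarrow> (real \<Rightarrow> complex) \<Rightarrow> real \<Rightarrow> complex" where
  "L0 a b y = (\<lambda>t. - (D_on a b ^^ 2) y t)"

definition L0_eigenvalues ::
  "real \<Rightarrow> real \<Rightarrow> (2 \<Rightarrow> complex poly) \<Rightarrow> (2 \<Rightarrow> complex poly) \<Rightarrow> complex set" where
  "L0_eigenvalues a b P Q = {\<mu>. \<exists>y\<in>L0_dom a b P Q.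
     (\<exists>t\<in>{a..b}. y t \<noteq> 0) \<and> (AE t in lebesgue_on {a..b}. L0 a b y t = \<mu> * y t)}"

text \<open>
  \<open>K\<close> is the continuous integral kernel of \<open>(L0 - \<mu>)\<^sup>-\<^sup>1\<close>: for every \<open>f\<close> in \<open>L\<^sub>2\<close> the equation
  \<open>(L0 - \<mu>) u = f\<close> has exactly one solution \<open>u\<close> in the domain (as a function on \<open>[a,b]\<close>), namely
  the integral of \<open>K x y * f y\<close>. Continuity determines \<open>K\<close> on the whole square, in particular
  on the diagonal, which is a null set.
\<close>

definition is_resolvent_kernel ::
  "real \<Rightarrow> real \<Rightarrow> (2 \<Rightarrow> complex poly) \<Rightarrow> (2 \<Rightarrow> complex poly) \<Rightarrow> complex
     \<Rightarrow> (real \<Rightarrow> real \<Rightarrow> complex) \<Rightarrow> bool" where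
  "is_resolvent_kernel a b P Q \<mu> K \<longleftrightarrow>
     continuous_on ({a..b} \<times> {a..b}) (\<lambda>(x, y). K x y)
     \<and> (\<forall>f. in_L2 a b f \<longrightarrow>
          (\<forall>u. (u \<in> L0_dom a b P Q \<and> (AE t in lebesgue_on {a..b}. L0 a b u t - \<mu> * u t = f t))
               \<longleftrightarrow> (\<forall>x\<in>{a..b}. u x = (\<integral>y. K x y * f y \<partial>lebesgue_on {a..b}))))"

text \<open>
  The spectrum being purely discrete, \<open>(L0 - \<mu>)\<^sup>-\<^sup>1\<close> exists exactly when \<open>\<mu>\<close> is not an eigenvalue.
\<close>

definition is_green_function ::
  "real \<Rightarrow> real \<Rightarrow> (2 \<Rightarrow> complex poly) \<Rightarrow> (2 \<Rightarrow> complex poly)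
     \<Rightarrow> (real \<Rightarrow> real \<Rightarrow> complex \<Rightarrow> complex) \<Rightarrow> bool" where
  "is_green_function a b P Q G \<longleftrightarrow>
     (\<forall>\<mu>. \<mu> \<notin> L0_eigenvalues a b P Q \<longrightarrow> is_resolvent_kernel a b P Q \<mu> (\<lambda>x y. G x y \<mu>))"

definition separated_from :: "(nat \<Rightarrow> real) \<Rightarrow> real set \<Rightarrow> bool" where
  "separated_from R S \<longleftrightarrow> (\<exists>\<delta>>0. \<forall>l. \<forall>r\<in>S. \<bar>R l - r\<bar> \<ge> \<delta>)"

end

theory Submission
  imports Defs
begin

text \<open>
  With \<open>\<mu> = z\<^sup>2\<close> the circle \<open>\<bar>\<mu>\<bar> = R\<^sup>2\<close> is the image of the half circle \<open>\<bar>z\<bar> = R\<close>,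
  \<open>Im z \<ge> 0\<close>. On that half circle the Green function is the kernel of the whole line,
  \<open>\<i> / (2 * z) * exp (\<i> * z * \<bar>x - y\<bar>)\<close>, plus a correction that carries the boundary
  conditions. On the diagonal this reads \<open>G\<^sub>0 x x \<mu> = \<i> / (2 * z) * (1 + E z)\<close>, so that
  \<open>(G\<^sub>0 x x \<mu>)\<^sup>2 = - (1 + E z)\<^sup>2 / (4 * \<mu>)\<close>. The term \<open>- 1 / (4 * \<mu>)\<close> alone contributes
  \<open>- 2 * pi * \<i> / 4\<close>, which is the asserted limit; what has to be shown is that \<open>E\<close> does not
  contribute.

  The correction is a combination of products of two exponentials, one decaying away from \<open>a\<close>
  and one decaying away from \<open>b\<close>, with coefficients obtained from Cramer's rule. Hence \<open>E z\<close> is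
  bounded by a constant times \<open>exp (- \<rho> * Im z)\<close>, where \<open>\<rho>\<close> is the distance of \<open>x\<close> to the
  endpoints, provided that the Cramer coefficients stay bounded. As \<open>\<rho> > 0\<close>, the correction then
  vanishes in the limit at every interior point of the half circle, and dominated convergence
  (lemma \<open>circle_integral_limit\<close>) finishes the proof.

  Boundedness of the coefficients is where Birkhoff regularity and the separation of the radii
  enter. The numerators grow no faster than the power of \<open>z\<close> that regularity assigns to the
  determinant in the denominator, so the question is a lower bound for the determinant
  with its power of \<open>z\<close> removed (lemma \<open>norm_det_bounded_below\<close>). The latter is a continuous function of \<open>1 / z\<close> and
  \<open>s = exp (\<i> * z * (b - a))\<close>, \<open>\<bar>s\<bar> \<le> 1\<close>, which for \<open>1 / z = 0\<close> is the regularity polynomial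
  \<open>\<theta>\<^sub>1 * s\<^sup>2 + \<theta>\<^sub>0 * s + \<theta>\<^sub>m\<close>. If it were small at points \<open>z\<close> of arbitrarily large half circles
  \<open>\<bar>z\<bar> = R\<close>, a subsequence of the \<open>s\<close> would converge to a root of this polynomial, and Hurwitz's theorem would
  put a true zero of the determinant within any given distance of \<open>z\<close>. But the square of such a
  zero is an eigenvalue (lemma \<open>square_is_eigenvalue_if_char_det_zero\<close>), which the separation of
  the radii excludes.

  The kernel is identified without any regularity theory: for continuous \<open>f\<close> the closed formula
  produces a classical solution (lemma \<open>green_kernel_solves\<close>), and testing against the conjugate
  of the difference of the two kernels shows that they agree
  (lemma \<open>resolvent_kernel_eq_green_kernel\<close>).
\<close>

section \<open>Classical solutions of the boundary value problem\<close>

lemma index_2_cases: "(j::2) = 0 \<or> j = 1"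
  using exhaust_2[of j] by auto

lemma poly_D_degree_le_1:
  assumes "degree p \<le> 1"
  shows "poly_D a b p y t = coeff p 0 * y t + coeff p 1 * D_on a b y t"
proof (cases "degree p = 0")
  case True
  then show ?thesis by (simp add: poly_D_def coeff_eq_0)
next
  case False
  with assms have "degree p = 1" by simp
  then show ?thesis by (simp add: poly_D_def)
qed

lemma poly_degree_le_1:
  fixes p :: "complex poly"
  assumes "degree p \<le> 1"
  shows "poly p w = coeff p 0 + coeff p 1 * w"
proof (cases "degree p = 0")
  case True
  then show ?thesis by (simp add: poly_altdef coeff_eq_0)
next
  case False
  with assms have "degree p = 1" by simp
  then show ?thesis by (simp add: poly_altdef)
qed

text \<open>A twice continuously differentiable function, with its one-sided derivatives at the
  endpoints. All functions whose membership in the domain of the operator is needed are of this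
  kind, so no absolute continuity argument beyond the Lipschitz bound occurs.\<close>

locale c2_function =
  fixes a b :: real and y y' y'' :: "real \<Rightarrow> complex"
  assumes ab: "a < b"
    and deriv: "\<And>t. t \<in> {a..b} \<Longrightarrow> (y has_vector_derivative y' t) (at t within {a..b})"
    and deriv': "\<And>t. t \<in> {a..b} \<Longrightarrow> (y' has_vector_derivative y'' t) (at t within {a..b})"
    and cont'': "continuous_on {a..b} y''"

lemma vector_derivative_Icc:
  fixes f :: "real \<Rightarrow> complex"
  assumes "a < b" "t \<in> {a..b}" "(f has_vector_derivative d) (at t within {a..b})"
  shows "vector_derivative f (at t within {a..b}) = d"
  using vector_derivative_within_cbox[of a b t f d] assms by simp

text \<open>A bound \<open>B\<close> for the derivative is a Lipschitz constant of \<open>f\<close>, so \<open>\<delta> = \<epsilon> / B\<close> works.\<close>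

lemma abs_cont_on_if_continuous_derivative:
  assumes d: "\<And>t. t \<in> {a..b} \<Longrightarrow> (f has_vector_derivative f' t) (at t within {a..b})"
    and c: "continuous_on {a..b} f'"
  shows "abs_cont_on a b f"
proof -
  have "bounded (f' ` {a..b})"
    using c compact_continuous_image compact_imp_bounded by blast
  then obtain B where B: "\<And>t. t \<in> {a..b} \<Longrightarrow> norm (f' t) \<le> B" and "B > 0"
    unfolding bounded_pos by (metis image_eqI)
  have lip: "norm (f r - f l) \<le> B * (r - l)" if "a \<le> l" "l \<le> r" "r \<le> b" for l r
  proof -
    have "norm (f r - f l) \<le> B * norm (r - l)"
    proof (rule differentiable_bound)
      show "convex {a..b}" by simp
      show "(f has_derivative (\<lambda>h. h *\<^sub>R f' t)) (at t within {a..b})" if "t \<in> {a..b}" for t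
        using d[OF that] by (simp add: has_vector_derivative_def)
      show "onorm (\<lambda>h. h *\<^sub>R f' t) \<le> B" if "t \<in> {a..b}" for t
        using B[OF that] by (intro onorm_le) (simp add: mult.commute[of B] mult_left_mono)
    qed (use that in auto)
    then show ?thesis using that by simp
  qed
  show ?thesis
    unfolding abs_cont_on_def
  proof (intro allI impI)
    fix \<epsilon> :: real assume "\<epsilon> > 0"
    show "\<exists>\<delta>>0. \<forall>S. finite S \<and> (\<forall>(l, r)\<in>S. a \<le> l \<and> l \<le> r \<and> r \<le> b)
        \<and> disjoint_family_on (\<lambda>(l, r). {l<..<r}) S \<and> (\<Sum>(l, r)\<in>S. r - l) < \<delta>
        \<longrightarrow> (\<Sum>(l, r)\<in>S. norm (f r - f l)) < \<epsilon>"
    proof (intro exI[of _ "\<epsilon> / B"] conjI allI impI)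
      show "0 < \<epsilon> / B" using \<open>\<epsilon> > 0\<close> \<open>B > 0\<close> by simp
      fix S :: "(real \<times> real) set"
      assume S: "finite S \<and> (\<forall>(l, r)\<in>S. a \<le> l \<and> l \<le> r \<and> r \<le> b)
        \<and> disjoint_family_on (\<lambda>(l, r). {l<..<r}) S \<and> (\<Sum>(l, r)\<in>S. r - l) < \<epsilon> / B"
      have "(\<Sum>(l, r)\<in>S. norm (f r - f l)) \<le> (\<Sum>(l, r)\<in>S. B * (r - l))"
        using S lip by (intro sum_mono) auto
      also have "\<dots> = B * (\<Sum>(l, r)\<in>S. r - l)"
        by (simp add: sum_distrib_left case_prod_unfold)
      also have "\<dots> < \<epsilon>"
        using S \<open>B > 0\<close> by (simp add: field_simps)
      finally show "(\<Sum>(l, r)\<in>S. norm (f r - f l)) < \<epsilon>" .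
    qed
  qed
qed

lemma in_L2_if_continuous:
  assumes "continuous_on {a..b} f"
  shows "in_L2 a b f"
  unfolding in_L2_def
  using assms
  by (auto intro!: continuous_imp_measurable_on_sets_lebesgue continuous_imp_integrable_real
      continuous_intros)

lemma in_L2_cong:
  assumes "\<And>t. t \<in> {a..b} \<Longrightarrow> f t = g t"
  shows "in_L2 a b f = in_L2 a b g"
  unfolding in_L2_def using assms
  by (intro conj_cong measurable_cong Bochner_Integration.integrable_cong) auto

context c2_function
begin

lemma D_on_eq: "t \<in> {a..b} \<Longrightarrow> D_on a b y t = y' t"
  unfolding D_on_def using vector_derivative_Icc[OF ab _ deriv] by simp

lemma deriv_D_on:
  assumes "t \<in> {a..b}"
  shows "(D_on a b y has_vector_derivative y'' t) (at t within {a..b})"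
  by (rule has_vector_derivative_transform[OF assms _ deriv'[OF assms]]) (simp add: D_on_eq)

lemma D_on_D_on_eq: "t \<in> {a..b} \<Longrightarrow> (D_on a b ^^ 2) y t = y'' t"
  using vector_derivative_Icc[OF ab _ deriv_D_on]
  by (simp add: numeral_2_eq_2) (simp add: D_on_def)

lemma cont': "continuous_on {a..b} y'"
  by (meson continuous_on_eq_continuous_within deriv' has_vector_derivative_continuous)

lemma in_L0_dom:
  assumes deg: "\<And>j. degree (P j) \<le> 1" "\<And>j. degree (Q j) \<le> 1"
    and bc: "\<And>j. coeff (P j) 0 * y a + coeff (P j) 1 * y' a
                 + (coeff (Q j) 0 * y b + coeff (Q j) 1 * y' b) = 0"
  shows "y \<in> L0_dom a b P Q"
  unfolding L0_dom_def
proof (intro CollectI conjI ballI allI)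
  show "y differentiable (at t within {a..b})" if "t \<in> {a..b}" for t
    using deriv[OF that] differentiableI_vector by blast
  show "abs_cont_on a b y"
    using abs_cont_on_if_continuous_derivative deriv cont' by blast
  show "abs_cont_on a b (D_on a b y)"
    using abs_cont_on_if_continuous_derivative deriv_D_on cont'' by blast
  show "AE t in lebesgue_on {a..b}. D_on a b y differentiable (at t within {a..b})"
    using deriv_D_on differentiableI_vector by (intro AE_I2) auto
  show "in_L2 a b ((D_on a b ^^ 2) y)"
    using in_L2_cong[of a b "(D_on a b ^^ 2) y" y''] D_on_D_on_eq in_L2_if_continuous[OF cont''] by simp
  show "poly_D a b (P j) y a + poly_D a b (Q j) y b = 0" for j
    using bc[of j] ab D_on_eq[of a] D_on_eq[of b]
    unfolding poly_D_degree_le_1[OF deg(1)] poly_D_degree_le_1[OF deg(2)] by simp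
qed

lemma AE_L0:
  assumes "\<And>t. t \<in> {a..b} \<Longrightarrow> - y'' t = g t"
  shows "AE t in lebesgue_on {a..b}. L0 a b y t = g t"
  using assms by (intro AE_I2) (simp add: L0_def D_on_D_on_eq)

end

section \<open>The exponential solutions and the characteristic determinant\<close>

text \<open>Of the two solutions of \<open>- y'' = z\<^sup>2 y\<close>, the first is normalised at \<open>a\<close> and the second
  at \<open>b\<close>; for \<open>Im z \<ge> 0\<close> this makes both bounded by \<open>1\<close> on the interval.\<close>

definition exp_left :: "real \<Rightarrow> complex \<Rightarrow> real \<Rightarrow> complex" where
  "exp_left a z t = exp (\<i> * z * of_real (t - a))"

definition exp_right :: "real \<Rightarrow> complex \<Rightarrow> real \<Rightarrow> complex" where
  "exp_right b z t = exp (\<i> * z * of_real (b - t))"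

text \<open>The boundary form \<open>(p(D) y)(a) + (q(D) y)(b)\<close> of a pair of polynomials \<open>p, q\<close> on these two solutions, where
  \<open>s\<close> is the value of either solution at its far endpoint.\<close>

definition bc_left :: "complex poly \<Rightarrow> complex poly \<Rightarrow> complex \<Rightarrow> complex \<Rightarrow> complex" where
  "bc_left p q z s = poly p (\<i> * z) + s * poly q (\<i> * z)"

definition bc_right :: "complex poly \<Rightarrow> complex poly \<Rightarrow> complex \<Rightarrow> complex \<Rightarrow> complex" where
  "bc_right p q z s = s * poly p (- (\<i> * z)) + poly q (- (\<i> * z))"

definition char_det :: "(2 \<Rightarrow> complex poly) \<Rightarrow> (2 \<Rightarrow> complex poly) \<Rightarrow> complex \<Rightarrow> complex \<Rightarrow> complex" where
  "char_det P Q z s = bc_left (P 0) (Q 0) z s * bc_right (P 1) (Q 1) z s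
                    - bc_right (P 0) (Q 0) z s * bc_left (P 1) (Q 1) z s"

lemma exp_left_derivative:
  "(exp_left a z has_vector_derivative \<i> * z * exp_left a z t) (at t within S)"
proof -
  have "((\<lambda>w. exp (\<i> * z * (w - of_real a))) has_field_derivative
      \<i> * z * exp_left a z t) (at (of_real t))"
    by (auto intro!: derivative_eq_intros simp: exp_left_def)
  from has_vector_derivative_real_field[OF this]
  show ?thesis
    by (simp add: exp_left_def[abs_def] o_def has_vector_derivative_at_within)
qed

lemma exp_right_derivative:
  "(exp_right b z has_vector_derivative - (\<i> * z * exp_right b z t)) (at t within S)"
proof -
  have "((\<lambda>w. exp (\<i> * z * (of_real b - w))) has_field_derivative
      - (\<i> * z * exp_right b z t)) (at (of_real t))"
    by (auto intro!: derivative_eq_intros simp: exp_right_def)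
  from has_vector_derivative_real_field[OF this]
  show ?thesis
    by (simp add: exp_right_def[abs_def] o_def has_vector_derivative_at_within)
qed

lemma continuous_on_exp_left: "continuous_on S (exp_left a z)"
  unfolding exp_left_def[abs_def] by (intro continuous_intros)

lemma continuous_on_exp_right: "continuous_on S (exp_right b z)"
  unfolding exp_right_def[abs_def] by (intro continuous_intros)

lemma exp_left_nonzero: "exp_left a z t \<noteq> 0"
  and exp_right_nonzero: "exp_right b z t \<noteq> 0"
  by (simp_all add: exp_left_def exp_right_def)

lemma exp_left_endpoints:
  "exp_left a z a = 1" "exp_left a z b = exp (\<i> * z * of_real (b - a))"
  by (simp_all add: exp_left_def)

lemma exp_right_endpoints:
  "exp_right b z b = 1" "exp_right b z a = exp (\<i> * z * of_real (b - a))"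
  by (simp_all add: exp_right_def)

text \<open>If the determinant vanishes, some nonzero combination of the two exponentials satisfies both
  boundary conditions. It is not the zero function, because \<open>\<i> * z * y + y'\<close> and
  \<open>\<i> * z * y - y'\<close> recover its two coefficients up to nonvanishing factors.\<close>

lemma square_is_eigenvalue_if_char_det_zero:
  assumes ab: "a < b" and deg: "\<And>j. degree (P j) \<le> 1" "\<And>j. degree (Q j) \<le> 1"
    and z: "z \<noteq> 0" and det: "char_det P Q z (exp (\<i> * z * of_real (b - a))) = 0"
  shows "z\<^sup>2 \<in> L0_eigenvalues a b P Q"
proof -
  define s where "s = exp (\<i> * z * of_real (b - a))"
  define \<alpha> where "\<alpha> j = bc_left (P j) (Q j) z s" for j
  define \<beta> where "\<beta> j = bc_right (P j) (Q j) z s" for j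
  have det': "\<alpha> 0 * \<beta> 1 = \<beta> 0 * \<alpha> 1"
    using det by (simp add: char_det_def \<alpha>_def \<beta>_def s_def)
  obtain c d where nz: "c \<noteq> 0 \<or> d \<noteq> 0"
    and cd01: "c * \<alpha> 0 + d * \<beta> 0 = 0" "c * \<alpha> 1 + d * \<beta> 1 = 0"
  proof (cases "\<alpha> 0 = 0 \<and> \<beta> 0 = 0")
    case True
    show ?thesis
    proof (cases "\<alpha> 1 = 0 \<and> \<beta> 1 = 0")
      case True
      with \<open>\<alpha> 0 = 0 \<and> \<beta> 0 = 0\<close> show ?thesis by (intro that[of 1 0]) auto
    next
      case False
      with \<open>\<alpha> 0 = 0 \<and> \<beta> 0 = 0\<close> show ?thesis
        by (intro that[of "\<beta> 1" "- \<alpha> 1"]) auto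
    qed
  next
    case False
    with det' show ?thesis
      by (intro that[of "\<beta> 0" "- \<alpha> 0"]) (auto simp: algebra_simps)
  qed
  have cd: "c * \<alpha> j + d * \<beta> j = 0" for j
    using index_2_cases[of j] cd01 by auto
  define y where "y t = c * exp_left a z t + d * exp_right b z t" for t
  define y' where "y' t = c * (\<i> * z * exp_left a z t) + d * (- (\<i> * z * exp_right b z t))" for t
  interpret c2_function a b y y' "\<lambda>t. - (z\<^sup>2 * y t)"
  proof
    show "(y has_vector_derivative y' t) (at t within {a..b})" for t
      unfolding y_def[abs_def] y'_def
      by (intro derivative_intros exp_left_derivative exp_right_derivative)
    have "(y' has_vector_derivative
        c * (\<i> * z * (\<i> * z * exp_left a z t)) + d * (- (\<i> * z * (- (\<i> * z * exp_right b z t)))))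
        (at t within {a..b})" for t
      unfolding y'_def[abs_def]
      by (intro derivative_intros exp_left_derivative exp_right_derivative)
    moreover have "c * (\<i> * z * (\<i> * z * exp_left a z t))
        + d * (- (\<i> * z * (- (\<i> * z * exp_right b z t)))) = - (z\<^sup>2 * y t)" for t
    proof -
      have "\<i> * \<i> = (-1::complex)" by simp
      then show ?thesis unfolding y_def power2_eq_square by algebra
    qed
    ultimately show "(y' has_vector_derivative - (z\<^sup>2 * y t)) (at t within {a..b})" for t
      by simp
    show "continuous_on {a..b} (\<lambda>t. - (z\<^sup>2 * y t))"
      unfolding y_def by (intro continuous_intros continuous_on_exp_left continuous_on_exp_right)
  qed (fact ab)
  have "y \<in> L0_dom a b P Q"
  proof (rule in_L0_dom[OF deg])
    fix j
    have "coeff (P j) 0 * y a + coeff (P j) 1 * y' a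
        + (coeff (Q j) 0 * y b + coeff (Q j) 1 * y' b) = c * \<alpha> j + d * \<beta> j"
      unfolding y_def y'_def \<alpha>_def \<beta>_def bc_left_def bc_right_def
        poly_degree_le_1[OF deg(1)] poly_degree_le_1[OF deg(2)]
      unfolding exp_left_endpoints exp_right_endpoints s_def[symmetric]
      by (simp add: algebra_simps)
    then show "coeff (P j) 0 * y a + coeff (P j) 1 * y' a
        + (coeff (Q j) 0 * y b + coeff (Q j) 1 * y' b) = 0"
      by (simp add: cd)
  qed
  moreover have "\<exists>t\<in>{a..b}. y t \<noteq> 0"
  proof (rule ccontr)
    assume "\<not> (\<exists>t\<in>{a..b}. y t \<noteq> 0)"
    then have y0: "y t = 0" if "t \<in> {a..b}" for t using that by blast
    have "y' a = 0"
    proof -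
      have "((\<lambda>_. 0) has_vector_derivative y' a) (at a within {a..b})"
        by (rule has_vector_derivative_transform[OF _ _ deriv]) (use ab y0 in auto)
      then show ?thesis
        using vector_derivative_Icc[OF ab, of a "\<lambda>_. 0" 0] vector_derivative_Icc[OF ab, of a "\<lambda>_. 0" "y' a"] ab
        by auto
    qed
    moreover have "y a = 0" using y0 ab by simp
    moreover have "2 * (\<i> * z) * (c * exp_left a z a) = \<i> * z * y a + y' a"
      "2 * (\<i> * z) * (d * exp_right b z a) = \<i> * z * y a - y' a"
      by (simp_all add: y_def y'_def algebra_simps)
    ultimately show False
      using nz z exp_left_nonzero exp_right_nonzero by auto
  qed
  moreover have "AE t in lebesgue_on {a..b}. L0 a b y t = z\<^sup>2 * y t"
    by (rule AE_L0) simp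
  ultimately show ?thesis
    unfolding L0_eigenvalues_def by blast
qed

section \<open>The Green function in closed form\<close>

locale two_point_problem =
  fixes a b :: real and P Q :: "2 \<Rightarrow> complex poly"
  assumes ab: "a < b"
    and deg: "\<And>j. degree (P j) \<le> 1" "\<And>j. degree (Q j) \<le> 1"
begin

text \<open>The value of either exponential solution at its far endpoint.\<close>

definition far :: "complex \<Rightarrow> complex" where
  "far z = exp (\<i> * z * of_real (b - a))"

text \<open>Cramer's rule for the combination of the two exponentials whose boundary forms are
  \<open>- \<kappa> 0\<close> and \<open>- \<kappa> 1\<close>.\<close>

definition kernel_coeff_left :: "(2 \<Rightarrow> complex) \<Rightarrow> complex \<Rightarrow> complex" where
  "kernel_coeff_left \<kappa> z = (bc_right (P 0) (Q 0) z (far z) * \<kappa> 1 - \<kappa> 0 * bc_right (P 1) (Q 1) z (far z))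
     / char_det P Q z (far z)"

definition kernel_coeff_right :: "(2 \<Rightarrow> complex) \<Rightarrow> complex \<Rightarrow> complex" where
  "kernel_coeff_right \<kappa> z = (\<kappa> 0 * bc_left (P 1) (Q 1) z (far z) - bc_left (P 0) (Q 0) z (far z) * \<kappa> 1)
     / char_det P Q z (far z)"

text \<open>The term \<open>exp (\<i> * z * \<bar>x - y\<bar>)\<close> equals \<open>exp_left a z y\<close> at \<open>x = a\<close>, with derivative
  \<open>- (\<i> * z)\<close> times its value, and \<open>exp_right b z y\<close> at \<open>x = b\<close>, with derivative \<open>\<i> * z\<close> times its
  value. Its boundary forms are therefore \<open>poly (P j) (- (\<i> * z)) * exp_left a z y
  + poly (Q j) (\<i> * z) * exp_right b z y\<close>, and these are the right-hand sides that the boundary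
  part of the kernel has to cancel.\<close>

definition boundary_kernel :: "complex \<Rightarrow> real \<Rightarrow> real \<Rightarrow> complex" where
  "boundary_kernel z x y =
     exp_left a z x * (kernel_coeff_left (\<lambda>j. poly (P j) (- (\<i> * z))) z * exp_left a z y
                     + kernel_coeff_left (\<lambda>j. poly (Q j) (\<i> * z)) z * exp_right b z y)
   + exp_right b z x * (kernel_coeff_right (\<lambda>j. poly (P j) (- (\<i> * z))) z * exp_left a z y
                     + kernel_coeff_right (\<lambda>j. poly (Q j) (\<i> * z)) z * exp_right b z y)"

definition green_kernel :: "complex \<Rightarrow> real \<Rightarrow> real \<Rightarrow> complex" where
  "green_kernel z x y = \<i> / (2 * z) * (exp (\<i> * z * of_real \<bar>x - y\<bar>) + boundary_kernel z x y)"

lemma kernel_coeff_cramer: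
  assumes "char_det P Q z (far z) \<noteq> 0"
  shows "kernel_coeff_left \<kappa> z * bc_left (P j) (Q j) z (far z)
       + kernel_coeff_right \<kappa> z * bc_right (P j) (Q j) z (far z) = - \<kappa> j"
proof -
  have "kernel_coeff_left \<kappa> z * bc_left (P j) (Q j) z (far z)
       + kernel_coeff_right \<kappa> z * bc_right (P j) (Q j) z (far z)
     = (- \<kappa> j * char_det P Q z (far z)) / char_det P Q z (far z)"
    unfolding kernel_coeff_left_def kernel_coeff_right_def
    using index_2_cases[of j]
    by (auto simp: char_det_def add_divide_distrib[symmetric] algebra_simps)
  then show ?thesis using assms by simp
qed

lemma exp_abs_diff:
  "y \<le> x \<Longrightarrow> exp (\<i> * z * of_real \<bar>x - y\<bar>) = exp_left a z x / exp_left a z y"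
  "x \<le> y \<Longrightarrow> exp (\<i> * z * of_real \<bar>x - y\<bar>) = exp_right b z x / exp_right b z y"
  by (simp_all add: exp_left_def exp_right_def exp_diff[symmetric] algebra_simps)

lemma exp_left_times_right: "exp_left a z y * exp_right b z y = far z"
  by (simp add: exp_left_def exp_right_def far_def exp_add[symmetric] algebra_simps)

lemma continuous_on_green_kernel: "continuous_on S (green_kernel z x)"
  unfolding green_kernel_def[abs_def] boundary_kernel_def
  by (intro continuous_intros continuous_on_exp_left continuous_on_exp_right)

text \<open>Variation of constants. The particular solution is \<open>k * (\<phi> * F + \<psi> * G)\<close>, where \<open>F t\<close>
  integrates \<open>f / \<phi>\<close> from \<open>a\<close> to \<open>t\<close> and \<open>G t\<close> integrates \<open>f / \<psi>\<close> from \<open>t\<close> to \<open>b\<close>. The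
  derivatives of \<open>F\<close> and \<open>G\<close> cancel in \<open>u'\<close>, whereas in \<open>u''\<close> they add up to
  \<open>2 * \<i> * z * k * f = - f\<close>; this fixes \<open>k = \<i> / (2 * z)\<close>.\<close>

lemma green_kernel_solves:
  assumes f: "continuous_on {a..b} f" and z: "z \<noteq> 0"
    and det: "char_det P Q z (far z) \<noteq> 0"
  obtains u where "u \<in> L0_dom a b P Q"
    "AE t in lebesgue_on {a..b}. L0 a b u t - z\<^sup>2 * u t = f t"
    "\<And>x. x \<in> {a..b} \<Longrightarrow> u x = integral {a..b} (\<lambda>y. green_kernel z x y * f y)"
proof -
  define \<phi> where "\<phi> = exp_left a z"
  define \<psi> where "\<psi> = exp_right b z"
  define k where "k = \<i> / (2 * z)"
  have c\<phi>: "continuous_on S \<phi>" and c\<psi>: "continuous_on S \<psi>" for S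
    unfolding \<phi>_def \<psi>_def by (rule continuous_on_exp_left continuous_on_exp_right)+
  have n\<phi>: "\<phi> t \<noteq> 0" and n\<psi>: "\<psi> t \<noteq> 0" for t
    by (simp_all add: \<phi>_def \<psi>_def exp_left_nonzero exp_right_nonzero)
  have d\<phi>: "(\<phi> has_vector_derivative \<i> * z * \<phi> t) (at t within S)"
    and d\<psi>: "(\<psi> has_vector_derivative - (\<i> * z * \<psi> t)) (at t within S)" for t S
    by (simp_all only: \<phi>_def \<psi>_def exp_left_derivative exp_right_derivative)
  have ends: "\<phi> a = 1" "\<phi> b = far z" "\<psi> a = far z" "\<psi> b = 1"
    by (simp_all add: \<phi>_def \<psi>_def far_def exp_left_endpoints exp_right_endpoints)
  have cq\<phi>: "continuous_on {a..b} (\<lambda>y. f y / \<phi> y)"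
    and cq\<psi>: "continuous_on {a..b} (\<lambda>y. f y / \<psi> y)"
    using n\<phi> n\<psi> by (auto intro!: continuous_intros f c\<phi> c\<psi>)
  have i\<phi>: "(\<lambda>y. \<phi> y * f y) integrable_on {a..b}" and i\<psi>: "(\<lambda>y. \<psi> y * f y) integrable_on {a..b}"
    by (auto intro!: integrable_continuous_real continuous_intros f c\<phi> c\<psi>)
  define A where "A = integral {a..b} (\<lambda>y. \<phi> y * f y)"
  define B where "B = integral {a..b} (\<lambda>y. \<psi> y * f y)"
  define F where "F t = integral {a..t} (\<lambda>y. f y / \<phi> y)" for t
  define G where "G t = integral {a..b} (\<lambda>y. f y / \<psi> y) - integral {a..t} (\<lambda>y. f y / \<psi> y)" for t
  have dF: "(F has_vector_derivative f t / \<phi> t) (at t within {a..b})" if "t \<in> {a..b}" for t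
    unfolding F_def[abs_def] by (rule integral_has_vector_derivative[OF cq\<phi> that])
  have dG: "(G has_vector_derivative - (f t / \<psi> t)) (at t within {a..b})" if "t \<in> {a..b}" for t
    unfolding G_def[abs_def]
    using has_vector_derivative_diff[OF has_vector_derivative_const integral_has_vector_derivative[OF cq\<psi> that]]
    by simp
  have prod: "\<phi> y * \<psi> y = far z" for y
    by (simp add: \<phi>_def \<psi>_def exp_left_times_right)
  have Fa: "F a = 0" and Gb: "G b = 0" by (simp_all add: F_def G_def)
  have Fb: "far z * F b = B"
  proof -
    have "far z * (f y / \<phi> y) = \<psi> y * f y" for y
      using n\<phi>[of y] prod[of y] by (auto simp: field_simps)
    then show ?thesis by (simp add: F_def B_def flip: integral_mult_right)
  qed
  have Ga: "far z * G a = A"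
  proof -
    have "far z * (f y / \<psi> y) = \<phi> y * f y" for y
      using n\<psi>[of y] prod[of y] by (auto simp: field_simps)
    then show ?thesis by (simp add: G_def A_def flip: integral_mult_right)
  qed
  define \<kappa> where "\<kappa> j = poly (P j) (- (\<i> * z))" for j
  define \<eta> where "\<eta> j = poly (Q j) (\<i> * z)" for j
  define c where "c = k * (kernel_coeff_left \<kappa> z * A + kernel_coeff_left \<eta> z * B)"
  define d where "d = k * (kernel_coeff_right \<kappa> z * A + kernel_coeff_right \<eta> z * B)"
  define u where "u t = k * (\<phi> t * F t + \<psi> t * G t) + c * \<phi> t + d * \<psi> t" for t
  define u' where "u' t = k * (\<i> * z) * (\<phi> t * F t - \<psi> t * G t)
      + c * (\<i> * z * \<phi> t) + d * (- (\<i> * z * \<psi> t))" for t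
  define u'' where "u'' t = - (z\<^sup>2 * u t) - f t" for t
  have ii: "\<i> * \<i> = (-1::complex)" by simp
  have kz: "k * (2 * z) = \<i>" using z by (simp add: k_def)
  interpret c2_function a b u u' u''
  proof
    show "a < b" by (fact ab)
    show du: "(u has_vector_derivative u' t) (at t within {a..b})" if t: "t \<in> {a..b}" for t
    proof -
      have "(u has_vector_derivative
          k * ((\<phi> t * (f t / \<phi> t) + \<i> * z * \<phi> t * F t) + (\<psi> t * (- (f t / \<psi> t)) + - (\<i> * z * \<psi> t) * G t))
          + c * (\<i> * z * \<phi> t) + d * (- (\<i> * z * \<psi> t))) (at t within {a..b})"
        unfolding u_def[abs_def] by (intro derivative_intros d\<phi> d\<psi> dF[OF t] dG[OF t])
      also have "k * ((\<phi> t * (f t / \<phi> t) + \<i> * z * \<phi> t * F t) + (\<psi> t * (- (f t / \<psi> t)) + - (\<i> * z * \<psi> t) * G t))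
          + c * (\<i> * z * \<phi> t) + d * (- (\<i> * z * \<psi> t)) = u' t"
        using n\<phi>[of t] n\<psi>[of t] by (simp add: u'_def algebra_simps)
      finally show ?thesis .
    qed
    show "(u' has_vector_derivative u'' t) (at t within {a..b})" if t: "t \<in> {a..b}" for t
    proof -
      have "(u' has_vector_derivative
          k * (\<i> * z) * ((\<phi> t * (f t / \<phi> t) + \<i> * z * \<phi> t * F t) - (\<psi> t * (- (f t / \<psi> t)) + - (\<i> * z * \<psi> t) * G t))
          + c * (\<i> * z * (\<i> * z * \<phi> t)) + d * (- (\<i> * z * (- (\<i> * z * \<psi> t))))) (at t within {a..b})"
        unfolding u'_def[abs_def] by (intro derivative_intros d\<phi> d\<psi> dF[OF t] dG[OF t])
      also have "k * (\<i> * z) * ((\<phi> t * (f t / \<phi> t) + \<i> * z * \<phi> t * F t) - (\<psi> t * (- (f t / \<psi> t)) + - (\<i> * z * \<psi> t) * G t))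
          + c * (\<i> * z * (\<i> * z * \<phi> t)) + d * (- (\<i> * z * (- (\<i> * z * \<psi> t))))
          = \<i> * (k * (2 * z)) * f t + (\<i> * \<i>) * z\<^sup>2 * u t"
        using n\<phi>[of t] n\<psi>[of t] by (simp add: u_def algebra_simps power2_eq_square)
      also have "\<dots> = u'' t" by (simp add: kz u''_def)
      finally show ?thesis .
    qed
    have "continuous_on {a..b} u"
      by (meson continuous_on_eq_continuous_within du has_vector_derivative_continuous)
    then show "continuous_on {a..b} u''"
      unfolding u''_def[abs_def] by (intro continuous_intros f)
  qed
  have "u \<in> L0_dom a b P Q"
  proof (rule in_L0_dom[OF deg])
    fix j
    have ua: "u a = k * A + c + d * far z" "u' a = k * (\<i> * z) * (- A) + \<i> * z * (c - d * far z)"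
      using Ga by (simp_all add: u_def u'_def ends Fa algebra_simps)
    have ub: "u b = k * B + c * far z + d" "u' b = k * (\<i> * z) * B + \<i> * z * (c * far z - d)"
      using Fb by (simp_all add: u_def u'_def ends Gb algebra_simps)
    have "coeff (P j) 0 * u a + coeff (P j) 1 * u' a
        + (coeff (Q j) 0 * u b + coeff (Q j) 1 * u' b)
        = k * (\<kappa> j * A + \<eta> j * B)
          + c * bc_left (P j) (Q j) z (far z) + d * bc_right (P j) (Q j) z (far z)"
      unfolding ua ub \<kappa>_def \<eta>_def bc_left_def bc_right_def
        poly_degree_le_1[OF deg(1)] poly_degree_le_1[OF deg(2)]
      by (simp add: algebra_simps)
    also have "\<dots> = k * (\<kappa> j + (kernel_coeff_left \<kappa> z * bc_left (P j) (Q j) z (far z)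
          + kernel_coeff_right \<kappa> z * bc_right (P j) (Q j) z (far z))) * A
        + k * (\<eta> j + (kernel_coeff_left \<eta> z * bc_left (P j) (Q j) z (far z)
          + kernel_coeff_right \<eta> z * bc_right (P j) (Q j) z (far z))) * B"
      by (simp add: c_def d_def algebra_simps)
    also have "\<dots> = 0"
      by (simp add: kernel_coeff_cramer[OF det])
    finally show "coeff (P j) 0 * u a + coeff (P j) 1 * u' a
        + (coeff (Q j) 0 * u b + coeff (Q j) 1 * u' b) = 0" .
  qed
  moreover have "AE t in lebesgue_on {a..b}. L0 a b u t - z\<^sup>2 * u t = f t"
    using AE_L0[of "\<lambda>t. z\<^sup>2 * u t + f t"] by (auto simp: u''_def)
  moreover have "u x = integral {a..b} (\<lambda>y. green_kernel z x y * f y)" if x: "x \<in> {a..b}" for x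
  proof -
    define E where "E y = exp (\<i> * z * of_real \<bar>x - y\<bar>) * f y" for y
    have iE: "E integrable_on {a..b}"
      unfolding E_def[abs_def] by (intro integrable_continuous_real continuous_intros f)
    have "integral {a..x} E = integral {a..x} (\<lambda>y. \<phi> x * (f y / \<phi> y))"
      by (rule integral_cong, unfold E_def \<phi>_def, subst exp_abs_diff(1)) auto
    moreover have "integral {x..b} E = integral {x..b} (\<lambda>y. \<psi> x * (f y / \<psi> y))"
      by (rule integral_cong, unfold E_def \<psi>_def, subst exp_abs_diff(2)) auto
    moreover have "integral {a..b} E = integral {a..x} E + integral {x..b} E"
      using Henstock_Kurzweil_Integration.integral_combine[OF _ _ iE, of x] x by simp
    moreover have "integral {x..b} (\<lambda>y. f y / \<psi> y) = G x"
      using Henstock_Kurzweil_Integration.integral_combine[OF _ _ integrable_continuous_real[OF cq\<psi>], of x] x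
      by (simp add: G_def algebra_simps)
    ultimately have intE: "integral {a..b} E = \<phi> x * F x + \<psi> x * G x"
      by (simp only: F_def integral_mult_right)
    have split: "(\<lambda>y. green_kernel z x y * f y) = (\<lambda>y. k * E y
        + (k * (\<phi> x * kernel_coeff_left \<kappa> z + \<psi> x * kernel_coeff_right \<kappa> z) * (\<phi> y * f y)
         + k * (\<phi> x * kernel_coeff_left \<eta> z + \<psi> x * kernel_coeff_right \<eta> z) * (\<psi> y * f y)))"
      unfolding green_kernel_def boundary_kernel_def E_def k_def[symmetric]
        \<kappa>_def[abs_def, symmetric] \<eta>_def[abs_def, symmetric] \<phi>_def \<psi>_def
      by (rule ext) (simp add: algebra_simps)
    have hE: "(E has_integral \<phi> x * F x + \<psi> x * G x) {a..b}"
      and hA: "((\<lambda>y. \<phi> y * f y) has_integral A) {a..b}"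
      and hB: "((\<lambda>y. \<psi> y * f y) has_integral B) {a..b}"
      using integrable_integral[OF iE] integrable_integral[OF i\<phi>] integrable_integral[OF i\<psi>]
      by (simp_all only: A_def B_def intE)
    have "((\<lambda>y. green_kernel z x y * f y) has_integral
        k * (\<phi> x * F x + \<psi> x * G x)
        + (k * (\<phi> x * kernel_coeff_left \<kappa> z + \<psi> x * kernel_coeff_right \<kappa> z) * A
         + k * (\<phi> x * kernel_coeff_left \<eta> z + \<psi> x * kernel_coeff_right \<eta> z) * B)) {a..b}"
      unfolding split by (intro has_integral_add has_integral_mult_right hE hA hB)
    then have integral_green: "integral {a..b} (\<lambda>y. green_kernel z x y * f y) =
        k * (\<phi> x * F x + \<psi> x * G x)
        + (k * (\<phi> x * kernel_coeff_left \<kappa> z + \<psi> x * kernel_coeff_right \<kappa> z) * A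
         + k * (\<phi> x * kernel_coeff_left \<eta> z + \<psi> x * kernel_coeff_right \<eta> z) * B)"
      by (rule integral_unique)
    show ?thesis unfolding integral_green u_def c_def d_def by algebra
  qed
  ultimately show ?thesis by (rule that)
qed

text \<open>For a fixed first argument, the difference \<open>e\<close> of the two kernels is orthogonal to every
  continuous function, in particular to itself.\<close>

lemma resolvent_kernel_eq_green_kernel:
  assumes K: "is_resolvent_kernel a b P Q (z\<^sup>2) K" and z: "z \<noteq> 0"
    and det: "char_det P Q z (far z) \<noteq> 0"
    and x: "x \<in> {a..b}" and y: "y \<in> {a..b}"
  shows "K x y = green_kernel z x y"
proof -
  have "continuous_on {a..b} (\<lambda>y. (\<lambda>(x, y). K x y) (x, y))"
  proof (rule continuous_on_compose2[of "{a..b} \<times> {a..b}" "\<lambda>(x, y). K x y" "{a..b}" "\<lambda>y. (x, y)"])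
    show "continuous_on ({a..b} \<times> {a..b}) (\<lambda>(x, y). K x y)"
      using K unfolding is_resolvent_kernel_def by blast
    show "continuous_on {a..b} (\<lambda>y. (x, y))" by (intro continuous_intros)
  qed (use x in auto)
  then have cK: "continuous_on {a..b} (K x)" by simp
  define e where "e y = K x y - green_kernel z x y" for y
  have ce: "continuous_on {a..b} e"
    unfolding e_def[abs_def] by (intro continuous_intros cK continuous_on_green_kernel)
  define f where "f y = cnj (e y)" for y
  have cf: "continuous_on {a..b} f"
    unfolding f_def[abs_def] by (intro continuous_intros ce)
  obtain u where u: "u \<in> L0_dom a b P Q"
    "AE t in lebesgue_on {a..b}. L0 a b u t - z\<^sup>2 * u t = f t"
    "u x = integral {a..b} (\<lambda>y. green_kernel z x y * f y)"
    using green_kernel_solves[OF cf z det] x by metis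
  have "u x = (\<integral>y. K x y * f y \<partial>lebesgue_on {a..b})"
    using K in_L2_if_continuous[OF cf] u x unfolding is_resolvent_kernel_def by blast
  also have "\<dots> = integral {a..b} (\<lambda>y. K x y * f y)"
    by (intro lebesgue_integral_eq_integral continuous_imp_integrable_real continuous_intros cK cf) simp
  finally have "integral {a..b} (\<lambda>y. K x y * f y) - integral {a..b} (\<lambda>y. green_kernel z x y * f y) = 0"
    using u by simp
  also have "integral {a..b} (\<lambda>y. K x y * f y) - integral {a..b} (\<lambda>y. green_kernel z x y * f y)
      = integral {a..b} (\<lambda>y. K x y * f y - green_kernel z x y * f y)"
    by (intro integral_diff[symmetric] integrable_continuous_real continuous_intros cK cf
        continuous_on_green_kernel)
  also have "(\<lambda>y. K x y * f y - green_kernel z x y * f y) = (\<lambda>y. complex_of_real ((cmod (e y))\<^sup>2))"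
    unfolding complex_norm_square f_def left_diff_distrib[symmetric] e_def[symmetric] by (rule refl)
  finally have "integral {a..b} (\<lambda>y. complex_of_real ((cmod (e y))\<^sup>2)) = 0" .
  moreover have ie: "(\<lambda>y. (cmod (e y))\<^sup>2) integrable_on {a..b}"
    by (intro integrable_continuous_real continuous_intros ce)
  moreover have "integral {a..b} (\<lambda>y. complex_of_real ((cmod (e y))\<^sup>2))
      = complex_of_real (integral {a..b} (\<lambda>y. (cmod (e y))\<^sup>2))"
    using has_integral_linear[OF integrable_integral[OF ie] bounded_linear_of_real]
    by (intro integral_unique) (simp only: o_def)
  ultimately have "integral {a..b} (\<lambda>y. (cmod (e y))\<^sup>2) = 0"
    by (simp only: of_real_eq_0_iff)
  then have "((\<lambda>y. (cmod (e y))\<^sup>2) has_integral 0) {a..b}"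
    using integrable_integral[OF ie] by (simp only:)
  then have "(cmod (e y))\<^sup>2 = 0"
    by (intro has_integral_0_cbox_imp_0[of a b "\<lambda>y. (cmod (e y))\<^sup>2" y])
       (use ab y in \<open>auto intro!: continuous_on_power continuous_on_norm ce\<close>)
  then show ?thesis by (simp add: e_def)
qed

end

section \<open>The normalised characteristic determinant\<close>

text \<open>For \<open>d \<ge> degree p\<close> this is \<open>\<zeta> ^ d * poly p (1 / \<zeta>)\<close>, extended to \<open>\<zeta> = 0\<close> by the coefficient
  of order \<open>d\<close>, which may vanish. In terms of \<open>\<zeta> = 1 / (\<i> * z)\<close>, the behaviour for large \<open>z\<close>
  becomes continuity at \<open>\<zeta> = 0\<close>.\<close>

definition homogenise :: "complex poly \<Rightarrow> nat \<Rightarrow> complex \<Rightarrow> complex" where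
  "homogenise p d \<zeta> = (\<Sum>i\<le>d. coeff p i * \<zeta> ^ (d - i))"

lemma poly_eq_homogenise:
  assumes "degree p \<le> d" "w \<noteq> 0"
  shows "poly p w = w ^ d * homogenise p d (1 / w)"
proof -
  have "poly p w = (\<Sum>i\<le>d. coeff p i * w ^ i)"
    unfolding poly_altdef using assms(1)
    by (intro sum.mono_neutral_left) (auto simp: coeff_eq_0)
  also have "\<dots> = (\<Sum>i\<le>d. w ^ d * (coeff p i * (1 / w) ^ (d - i)))"
  proof (rule sum.cong[OF refl])
    fix i assume "i \<in> {..d}"
    then have "w ^ d = w ^ i * w ^ (d - i)" by (simp flip: power_add)
    then show "coeff p i * w ^ i = w ^ d * (coeff p i * (1 / w) ^ (d - i))"
      using assms(2) by (simp add: power_one_over)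
  qed
  finally show ?thesis by (simp add: homogenise_def sum_distrib_left)
qed

lemma homogenise_0: "homogenise p d 0 = coeff p d"
proof -
  have "homogenise p d 0 = (\<Sum>i\<le>d. if i = d then coeff p i else 0)"
    unfolding homogenise_def by (intro sum.cong) auto
  then show ?thesis by simp
qed

lemma continuous_on_homogenise [continuous_intros]:
  "continuous_on S f \<Longrightarrow> continuous_on S (\<lambda>x. homogenise p d (f x))"
  unfolding homogenise_def by (intro continuous_intros)

lemma holomorphic_on_homogenise [holomorphic_intros]:
  "f holomorphic_on S \<Longrightarrow> (\<lambda>x. homogenise p d (f x)) holomorphic_on S"
  unfolding homogenise_def by (intro holomorphic_intros)

context two_point_problem
begin

abbreviation ord :: "2 \<Rightarrow> nat" where "ord \<equiv> bc_order P Q"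

text \<open>The boundary forms of the exponentials and their determinant, divided by the power
  \<open>(\<i> * z) ^ ord j\<close> of each row, as functions of \<open>\<zeta> = 1 / (\<i> * z)\<close>.\<close>

definition norm_left :: "2 \<Rightarrow> complex \<Rightarrow> complex \<Rightarrow> complex" where
  "norm_left j \<zeta> s = homogenise (P j) (ord j) \<zeta> + s * homogenise (Q j) (ord j) \<zeta>"

definition norm_right :: "2 \<Rightarrow> complex \<Rightarrow> complex \<Rightarrow> complex" where
  "norm_right j \<zeta> s = (- 1) ^ ord j *
     (s * homogenise (P j) (ord j) (- \<zeta>) + homogenise (Q j) (ord j) (- \<zeta>))"

definition norm_det :: "complex \<Rightarrow> complex \<Rightarrow> complex" where
  "norm_det \<zeta> s = norm_left 0 \<zeta> s * norm_right 1 \<zeta> s - norm_right 0 \<zeta> s * norm_left 1 \<zeta> s"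

lemma poly_at_iz:
  assumes "z \<noteq> 0"
  shows "poly (P j) (\<i> * z) = (\<i> * z) ^ ord j * homogenise (P j) (ord j) (1 / (\<i> * z))"
    "poly (Q j) (\<i> * z) = (\<i> * z) ^ ord j * homogenise (Q j) (ord j) (1 / (\<i> * z))"
    "poly (P j) (- (\<i> * z)) = (\<i> * z) ^ ord j * ((- 1) ^ ord j * homogenise (P j) (ord j) (- (1 / (\<i> * z))))"
    "poly (Q j) (- (\<i> * z)) = (\<i> * z) ^ ord j * ((- 1) ^ ord j * homogenise (Q j) (ord j) (- (1 / (\<i> * z))))"
proof -
  have d: "degree (P j) \<le> ord j" "degree (Q j) \<le> ord j" by (simp_all add: bc_order_def)
  have nz: "\<i> * z \<noteq> 0" "- (\<i> * z) \<noteq> 0" using assms by simp_all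
  have "(- (\<i> * z)) ^ ord j = (\<i> * z) ^ ord j * (- 1) ^ ord j"
    by (metis mult.commute power_minus)
  moreover have "1 / - (\<i> * z) = - (1 / (\<i> * z))" by simp
  ultimately show "poly (P j) (\<i> * z) = (\<i> * z) ^ ord j * homogenise (P j) (ord j) (1 / (\<i> * z))"
    "poly (Q j) (\<i> * z) = (\<i> * z) ^ ord j * homogenise (Q j) (ord j) (1 / (\<i> * z))"
    "poly (P j) (- (\<i> * z)) = (\<i> * z) ^ ord j * ((- 1) ^ ord j * homogenise (P j) (ord j) (- (1 / (\<i> * z))))"
    "poly (Q j) (- (\<i> * z)) = (\<i> * z) ^ ord j * ((- 1) ^ ord j * homogenise (Q j) (ord j) (- (1 / (\<i> * z))))"
    using poly_eq_homogenise[OF d(1) nz(1)] poly_eq_homogenise[OF d(2) nz(1)]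
      poly_eq_homogenise[OF d(1) nz(2)] poly_eq_homogenise[OF d(2) nz(2)]
    by (simp_all only: mult.assoc)
qed

lemma bc_left_eq: "z \<noteq> 0 \<Longrightarrow> bc_left (P j) (Q j) z s = (\<i> * z) ^ ord j * norm_left j (1 / (\<i> * z)) s"
  unfolding bc_left_def norm_left_def by (simp only: poly_at_iz not_False_eq_True) algebra

lemma bc_right_eq: "z \<noteq> 0 \<Longrightarrow> bc_right (P j) (Q j) z s = (\<i> * z) ^ ord j * norm_right j (1 / (\<i> * z)) s"
  unfolding bc_right_def norm_right_def by (simp only: poly_at_iz not_False_eq_True) algebra

lemma char_det_eq:
  "z \<noteq> 0 \<Longrightarrow> char_det P Q z s = (\<i> * z) ^ ord 0 * (\<i> * z) ^ ord 1 * norm_det (1 / (\<i> * z)) s"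
  unfolding char_det_def norm_det_def by (simp only: bc_left_eq bc_right_eq not_False_eq_True) algebra

lemma continuous_on_norm_det:
  "continuous_on S f \<Longrightarrow> continuous_on S g \<Longrightarrow> continuous_on S (\<lambda>x. norm_det (f x) (g x))"
  unfolding norm_det_def norm_left_def norm_right_def by (intro continuous_intros)

lemma holomorphic_on_norm_det:
  "f holomorphic_on S \<Longrightarrow> g holomorphic_on S \<Longrightarrow> (\<lambda>x. norm_det (f x) (g x)) holomorphic_on S"
  unfolding norm_det_def norm_left_def norm_right_def by (intro holomorphic_intros)

text \<open>At \<open>\<zeta> = 0\<close> only the leading coefficients survive, and the second column of the matrix in the
  definition of regularity, multiplied by \<open>s\<close>, is the column of the right exponential.
  Regularity speaks of \<open>s \<noteq> 0\<close> only; comparing the two quadratic polynomials in \<open>s\<close> at three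
  points carries the identity over to \<open>s = 0\<close>.\<close>

lemma norm_det_at_infinity:
  assumes "birkhoff_regular P Q"
  obtains \<theta>\<^sub>1 \<theta>\<^sub>0 \<theta>\<^sub>m where "\<And>s. norm_det 0 s = \<theta>\<^sub>1 * s\<^sup>2 + \<theta>\<^sub>0 * s + \<theta>\<^sub>m" "\<theta>\<^sub>1 \<noteq> 0" "\<theta>\<^sub>m \<noteq> 0"
proof -
  define p where "p j = lead_a P Q j" for j
  define q where "q j = lead_b P Q j" for j
  obtain \<theta>\<^sub>1 \<theta>\<^sub>0 \<theta>\<^sub>m where
    \<theta>: "\<And>s. s \<noteq> 0 \<Longrightarrow> (p 0 + s * q 0) * ((- 1) ^ ord 1 * (p 1 + q 1 / s))
          - (- 1) ^ ord 0 * (p 0 + q 0 / s) * (p 1 + s * q 1) = \<theta>\<^sub>1 * s + \<theta>\<^sub>0 + \<theta>\<^sub>m / s"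
    and nz: "\<theta>\<^sub>1 \<noteq> 0" "\<theta>\<^sub>m \<noteq> 0"
    using assms unfolding birkhoff_regular_def det_2 vector_2 p_def q_def by blast
  define A where "A = (- 1) ^ ord 1 * q 0 * p 1 - (- 1) ^ ord 0 * p 0 * q 1"
  define B where "B = ((- 1) ^ ord 1 - (- 1) ^ ord 0) * (p 0 * p 1 + q 0 * q 1)"
  define C where "C = (- 1) ^ ord 1 * p 0 * q 1 - (- 1) ^ ord 0 * q 0 * p 1"
  have expand: "norm_det 0 s = A * s\<^sup>2 + B * s + C" for s
    by (simp add: norm_det_def norm_left_def norm_right_def homogenise_0 A_def B_def C_def
        p_def q_def lead_a_def lead_b_def power2_eq_square algebra_simps)
  have eq: "A * s\<^sup>2 + B * s + C = \<theta>\<^sub>1 * s\<^sup>2 + \<theta>\<^sub>0 * s + \<theta>\<^sub>m" if "s \<noteq> 0" for s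
  proof -
    have "(\<theta>\<^sub>1 * s + \<theta>\<^sub>0 + \<theta>\<^sub>m / s) * s = \<theta>\<^sub>1 * s\<^sup>2 + \<theta>\<^sub>0 * s + \<theta>\<^sub>m"
      using that by (simp add: field_simps power2_eq_square)
    moreover have "((p 0 + s * q 0) * ((- 1) ^ ord 1 * (p 1 + q 1 / s))
          - (- 1) ^ ord 0 * (p 0 + q 0 / s) * (p 1 + s * q 1)) * s = A * s\<^sup>2 + B * s + C"
      using that by (simp add: A_def B_def C_def field_simps power2_eq_square)
    ultimately show ?thesis using \<theta>[OF that] by simp
  qed
  \<comment> \<open>Any three nonzero points determine a quadratic polynomial.\<close>
  have "A = \<theta>\<^sub>1" "C = \<theta>\<^sub>m" "B = \<theta>\<^sub>0"
    using eq[of 1] eq[of "-1"] eq[of 2] by (simp_all, algebra+)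
  with expand show ?thesis by (intro that[of \<theta>\<^sub>1 \<theta>\<^sub>0 \<theta>\<^sub>m] nz) simp
qed

lemma norm_far_le_1: "Im z \<ge> 0 \<Longrightarrow> cmod (far z) \<le> 1"
  using ab by (simp add: far_def)

lemma far_add: "far (z + v) = far z * far v"
  unfolding far_def exp_add[symmetric] by (simp add: algebra_simps)

lemma norm_inverse_iz: "cmod (1 / (\<i> * z)) = 1 / cmod z"
  unfolding norm_divide norm_mult by simp

text \<open>If the bound fails, there are \<open>z n\<close> with modulus tending to infinity at which the normalised determinant
  tends to zero. Since the closed unit disc is compact, a subsequence of \<open>far (z n)\<close> converges
  to some \<open>s\<close>, and the translates \<open>F n v\<close> of the normalised determinant to \<open>z n + v\<close> converge
  locally uniformly to \<open>norm_det 0 (s * far v)\<close>. This limit vanishes at \<open>v = 0\<close> although no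
  \<open>F n\<close> has a zero in the disc of radius \<open>\<delta>\<close>, which contradicts Hurwitz's theorem unless the
  limit is constant. Regularity excludes the latter: \<open>s = 0\<close> would give \<open>\<theta>\<^sub>m = 0\<close>, and for
  \<open>s \<noteq> 0\<close> constancy would give \<open>\<theta>\<^sub>1 = 0\<close>.\<close>

lemma norm_det_bounded_below:
  assumes reg: "birkhoff_regular P Q" and \<delta>: "\<delta> > 0" and R: "filterlim R at_top sequentially"
    and zero_free: "\<And>l w. w \<noteq> 0 \<Longrightarrow> \<bar>R l - cmod w\<bar> < \<delta> \<Longrightarrow> norm_det (1 / (\<i> * w)) (far w) \<noteq> 0"
  obtains c L where "c > 0"
    "\<And>l z. l \<ge> L \<Longrightarrow> cmod z = R l \<Longrightarrow> Im z \<ge> 0 \<Longrightarrow> c \<le> cmod (norm_det (1 / (\<i> * z)) (far z))"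
proof (rule ccontr)
  assume neg: "\<not> thesis"
  have "\<exists>l z. l \<ge> n \<and> cmod z = R l \<and> Im z \<ge> 0
      \<and> cmod (norm_det (1 / (\<i> * z)) (far z)) < 1 / real (Suc n)" for n
    using neg that[of "1 / real (Suc n)" n] by (metis not_le of_nat_0_less_iff zero_less_Suc zero_less_divide_1_iff)
  then obtain l z where l: "\<And>n. l n \<ge> n" and z: "\<And>n. cmod (z n) = R (l n)" "\<And>n. Im (z n) \<ge> 0"
    and small: "\<And>n. cmod (norm_det (1 / (\<i> * z n)) (far (z n))) < 1 / real (Suc n)"
    by metis
  have Rl: "filterlim (\<lambda>n. cmod (z n)) at_top sequentially"
    unfolding z(1)
    by (rule filterlim_compose[OF R filterlim_at_top_mono[OF filterlim_ident]]) (simp add: l)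
  obtain s r where s: "s \<in> cball 0 1" and r: "strict_mono r"
    and lim_s: "((\<lambda>n. far (z n)) \<circ> r) \<longlonglongrightarrow> s"
  proof (rule seq_compactE)
    show "seq_compact (cball (0::complex) 1)"
      using compact_cball compact_eq_seq_compact_metric by blast
    show "\<forall>n. far (z n) \<in> cball 0 1"
      using norm_far_le_1 z(2) by simp
  qed
  have Rr: "filterlim (\<lambda>n. cmod (z (r n))) at_top sequentially"
    using filterlim_compose[OF Rl filterlim_subseq[OF r]] .
  \<comment> \<open>Dropping an initial segment keeps \<open>z + v\<close> at distance at least \<open>1\<close> from \<open>0\<close> for
    \<open>\<bar>v\<bar> < \<delta>\<close>, so that \<open>1 / (z + v)\<close> is holomorphic and stays in the unit disc.\<close>
  then obtain N where N: "\<And>n. n \<ge> N \<Longrightarrow> cmod (z (r n)) \<ge> \<delta> + 1"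
    by (auto simp: filterlim_at_top eventually_sequentially)
  define w where "w n = z (r (n + N))" for n
  have w_ge: "cmod (w n) \<ge> \<delta> + 1" for n using N by (simp add: w_def)
  have w_top: "filterlim (\<lambda>n. cmod (w n)) at_top sequentially"
    using filterlim_compose[OF Rr filterlim_add_const_nat_at_top[of N]] by (simp add: w_def)
  have w_far: "(\<lambda>n. far (w n)) \<longlonglongrightarrow> s"
    using LIMSEQ_ignore_initial_segment[OF lim_s, of N] by (simp add: w_def)
  have w_Im: "Im (w n) \<ge> 0" for n using z(2) by (simp add: w_def)
  define F where "F n v = norm_det (1 / (\<i> * (w n + v))) (far (w n) * far v)" for n v
  define F' where "F' v = norm_det 0 (s * far v)" for v
  obtain \<theta>\<^sub>1 \<theta>\<^sub>0 \<theta>\<^sub>m where \<theta>: "\<And>s. norm_det 0 s = \<theta>\<^sub>1 * s\<^sup>2 + \<theta>\<^sub>0 * s + \<theta>\<^sub>m" "\<theta>\<^sub>1 \<noteq> 0" "\<theta>\<^sub>m \<noteq> 0"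
    using norm_det_at_infinity[OF reg] by blast
  have w_plus: "cmod (w n + v) \<ge> cmod (w n) - \<delta>" "w n + v \<noteq> 0" if "v \<in> ball 0 \<delta>" for n v
  proof -
    show *: "cmod (w n + v) \<ge> cmod (w n) - \<delta>"
      using norm_diff_ineq[of "w n" v] that by simp
    then show "w n + v \<noteq> 0" using w_ge[of n] by auto
  qed
  have unif: "uniform_limit K F F' sequentially" if K: "compact K" "K \<subseteq> ball 0 \<delta>" for K
  proof -
    have cont_far: "continuous_on K far"
      unfolding far_def by (intro continuous_intros)
    then obtain M where M: "\<And>v. v \<in> K \<Longrightarrow> cmod (far v) \<le> M" and "M > 0"
      using compact_imp_bounded[OF compact_continuous_image[OF cont_far K(1)]]
      unfolding bounded_pos by (metis image_eqI)
    define U where "U = cball (0::complex) 1 \<times> cball (0::complex) M"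
    have uc: "uniformly_continuous_on U (\<lambda>(\<zeta>, s). norm_det \<zeta> s)"
      unfolding U_def case_prod_unfold
      by (intro compact_uniformly_continuous continuous_on_norm_det continuous_intros compact_Times)
         auto
    have ul: "uniform_limit K (\<lambda>n v. (1 / (\<i> * (w n + v)), far (w n) * far v)) (\<lambda>v. (0, s * far v)) sequentially"
    proof (rule uniform_limitI)
      fix e :: real assume e: "e > 0"
      have "eventually (\<lambda>n. cmod (w n) \<ge> \<delta> + 1 + 2 / e) sequentially"
        using w_top by (auto simp: filterlim_at_top)
      moreover have "eventually (\<lambda>n. dist (far (w n)) s < e / (2 * M)) sequentially"
        using w_far e \<open>M > 0\<close> by (intro tendstoD) auto
      ultimately show "eventually (\<lambda>n. \<forall>v\<in>K. dist (1 / (\<i> * (w n + v)), far (w n) * far v) (0, s * far v) < e) sequentially"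
      proof eventually_elim
        case (elim n)
        show ?case
        proof
          fix v assume v: "v \<in> K"
          define m where "m = cmod (w n + v)"
          have "v \<in> ball 0 \<delta>" using v K(2) by blast
          then have "m > 2 / e"
            using w_plus(1)[of v n] elim(1) unfolding m_def by linarith
          moreover from this have "m > 0"
            using e by (meson divide_pos_pos less_trans zero_less_numeral)
          ultimately have "1 / m < e / 2"
            using e by (simp add: field_simps)
          then have "cmod (1 / (\<i> * (w n + v))) < e / 2"
            unfolding norm_inverse_iz m_def .
          moreover have "cmod (far (w n) * far v - s * far v) < e / 2"
          proof -
            have "cmod (far (w n) * far v - s * far v) = cmod (far (w n) - s) * cmod (far v)"
              by (simp flip: norm_mult left_diff_distrib)
            also have "\<dots> \<le> cmod (far (w n) - s) * M"
              by (intro mult_left_mono M v) simp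
            also have "\<dots> < e / (2 * M) * M"
              using elim(2) \<open>M > 0\<close> by (intro mult_strict_right_mono) (auto simp: dist_norm)
            finally show ?thesis using \<open>M > 0\<close> by simp
          qed
          ultimately show "dist (1 / (\<i> * (w n + v)), far (w n) * far v) (0, s * far v) < e"
            using norm_Pair_le[of "1 / (\<i> * (w n + v))" "far (w n) * far v - s * far v"]
            by (simp add: dist_norm)
        qed
      qed
    qed
    have ev: "eventually (\<lambda>n. \<forall>v\<in>K. (1 / (\<i> * (w n + v)), far (w n) * far v) \<in> U) sequentially"
    proof (intro always_eventually allI ballI)
      fix n v assume v: "v \<in> K"
      have "v \<in> ball 0 \<delta>" using v K(2) by blast
      then have "cmod (w n + v) \<ge> 1"
        using w_plus(1)[of v n] w_ge[of n] by linarith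
      moreover have "cmod (far (w n)) * cmod (far v) \<le> 1 * M"
        by (intro mult_mono norm_far_le_1 w_Im M v) auto
      ultimately show "(1 / (\<i> * (w n + v)), far (w n) * far v) \<in> U"
        unfolding U_def mem_Times_iff mem_cball_0 norm_inverse_iz fst_conv snd_conv norm_mult
        by (simp add: divide_le_eq)
    qed
    have "closed U" unfolding U_def by (intro closed_Times closed_cball)
    from uniform_limit_compose_uniformly_continuous_on[OF ul uc ev this]
    show ?thesis by (simp add: F_def[abs_def] F'_def[abs_def])
  qed
  have "F' 0 = 0"
  proof -
    have "(\<lambda>n. F n 0) \<longlonglongrightarrow> F' 0"
      using unif[of "{0}"] \<delta> by (auto intro: tendsto_uniform_limitI)
    moreover have "(\<lambda>n. F n 0) \<longlonglongrightarrow> 0"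
    proof (rule Lim_null_comparison[OF always_eventually])
      show "\<forall>n. norm (F n 0) \<le> 1 / real (Suc n)"
      proof
        fix n
        have "norm (F n 0) < 1 / real (Suc (r (n + N)))"
          using small[of "r (n + N)"] by (simp add: F_def w_def far_def)
        also have "\<dots> \<le> 1 / real (Suc n)"
          using seq_suble[OF r, of "n + N"] by (intro divide_left_mono) auto
        finally show "norm (F n 0) \<le> 1 / real (Suc n)" by simp
      qed
      show "(\<lambda>n. 1 / real (Suc n)) \<longlonglongrightarrow> 0"
        using LIMSEQ_inverse_real_of_nat by (simp add: inverse_eq_divide)
    qed
    ultimately show ?thesis using LIMSEQ_unique by blast
  qed
  then have "s \<noteq> 0" using \<theta> by (auto simp: F'_def)
  have "F' 0 \<noteq> 0"
  proof (rule Hurwitz_no_zeros[of "ball 0 \<delta>" F F'])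
    show "F n holomorphic_on ball 0 \<delta>" for n
      unfolding F_def[abs_def] far_def using w_plus(2)
      by (intro holomorphic_on_norm_det holomorphic_intros) auto
    show "F' holomorphic_on ball 0 \<delta>"
      unfolding F'_def[abs_def] far_def
      by (intro holomorphic_on_norm_det holomorphic_intros)
    show "uniform_limit K F F' sequentially" if "compact K" "K \<subseteq> ball 0 \<delta>" for K
      using unif that .
    show "F n v \<noteq> 0" if "v \<in> ball 0 \<delta>" for n v
    proof -
      have "\<bar>R (l (r (n + N))) - cmod (w n + v)\<bar> < \<delta>"
        using norm_triangle_ineq3[of "w n" "w n + v"] that
        by (simp add: z(1)[symmetric] w_def[symmetric])
      then show ?thesis
        using zero_free[of "w n + v"] w_plus(2)[OF that] by (simp add: F_def far_add)
    qed
    show "\<not> F' constant_on ball 0 \<delta>"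
    proof
      assume const: "F' constant_on ball 0 \<delta>"
      define h where "h = \<i> * of_real (b - a)"
      have "h \<noteq> 0" using ab by (simp add: h_def)
      have dfar: "(far has_field_derivative h * far v) (at v)" for v
        unfolding far_def[abs_def] h_def by (auto intro!: derivative_eq_intros)
      \<comment> \<open>As \<open>F'\<close> is quadratic in \<open>far\<close> and \<open>far\<close> solves \<open>y' = h * y\<close>, differentiating twice isolates \<open>\<theta>\<^sub>1\<close>.\<close>
      have zero1: "2 * \<theta>\<^sub>1 * (s * far v) + \<theta>\<^sub>0 = 0" if v: "v \<in> ball 0 \<delta>" for v
      proof -
        have "(F' has_field_derivative (h * s * far v) * (2 * \<theta>\<^sub>1 * (s * far v) + \<theta>\<^sub>0)) (at v)"
          unfolding F'_def[abs_def] \<theta>(1)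
          by (auto intro!: derivative_eq_intros dfar simp: algebra_simps power2_eq_square)
        moreover have "(F' has_field_derivative 0) (at v)"
        proof -
          obtain c where "\<And>v. v \<in> ball 0 \<delta> \<Longrightarrow> F' v = c"
            using const by (auto simp: constant_on_def)
          then show ?thesis
            by (intro has_field_derivative_transform_within_open[OF DERIV_const[of c] _ v]) auto
        qed
        ultimately have "(h * s * far v) * (2 * \<theta>\<^sub>1 * (s * far v) + \<theta>\<^sub>0) = 0"
          by (rule DERIV_unique)
        then show ?thesis using \<open>h \<noteq> 0\<close> \<open>s \<noteq> 0\<close> by (simp add: far_def)
      qed
      have "((\<lambda>v. 2 * \<theta>\<^sub>1 * (s * far v) + \<theta>\<^sub>0) has_field_derivative 2 * \<theta>\<^sub>1 * (s * (h * far 0))) (at 0)"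
        by (auto intro!: derivative_eq_intros dfar)
      moreover have "((\<lambda>v. 2 * \<theta>\<^sub>1 * (s * far v) + \<theta>\<^sub>0) has_field_derivative 0) (at 0)"
        by (intro has_field_derivative_transform_within_open[OF DERIV_const[of 0], of "ball 0 \<delta>"])
           (use zero1 \<delta> in auto)
      ultimately have "2 * \<theta>\<^sub>1 * (s * (h * far 0)) = 0"
        by (rule DERIV_unique)
      then show False
        using \<theta>(2) \<open>s \<noteq> 0\<close> \<open>h \<noteq> 0\<close> by (simp add: far_def)
    qed
  qed (use \<delta> in auto)
  with \<open>F' 0 = 0\<close> show False by simp
qed

end

section \<open>The boundary part of the Green function on the diagonal\<close>

lemma homogenise_bounded:
  assumes "cmod \<zeta> \<le> 1"
  shows "cmod (homogenise p d \<zeta>) \<le> (\<Sum>i\<le>d. cmod (coeff p i))"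
proof -
  have "cmod (homogenise p d \<zeta>) \<le> (\<Sum>i\<le>d. cmod (coeff p i * \<zeta> ^ (d - i)))"
    unfolding homogenise_def by (rule norm_sum)
  also have "\<dots> \<le> (\<Sum>i\<le>d. cmod (coeff p i))"
    by (intro sum_mono) (simp add: norm_mult norm_power assms power_le_one mult_left_le)
  finally show ?thesis .
qed

text \<open>For Cramer's quotients \<open>p\<close> and \<open>q\<close> are the powers of \<open>\<i> * z\<close> carried by the two rows. They
  cancel, so that only the normalised determinant \<open>D\<close> is left in the denominator.\<close>

lemma det_quotient_bounded:
  fixes p q D :: complex
  assumes "p \<noteq> 0" "q \<noteq> 0" "c > 0" "c \<le> cmod D"
    and "cmod u0 \<le> M" "cmod u1 \<le> M" "cmod v0 \<le> M" "cmod v1 \<le> M"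
  shows "cmod ((p * u0 * (q * v1) - p * v0 * (q * u1)) / (p * q * D)) \<le> 2 * M\<^sup>2 / c"
proof -
  have "(p * u0 * (q * v1) - p * v0 * (q * u1)) / (p * q * D)
      = (p * q * (u0 * v1 - v0 * u1)) / (p * q * D)"
    by (simp add: algebra_simps)
  also have "\<dots> = (u0 * v1 - v0 * u1) / D"
    using assms(1,2) by simp
  also have "cmod \<dots> = cmod (u0 * v1 - v0 * u1) / cmod D"
    by (rule norm_divide)
  also have "\<dots> \<le> 2 * M\<^sup>2 / c"
  proof (rule frac_le)
    have M0: "M \<ge> 0" using assms(5) norm_ge_zero order_trans by blast
    have "cmod (u0 * v1 - v0 * u1) \<le> cmod u0 * cmod v1 + cmod v0 * cmod u1"
      unfolding norm_mult[symmetric] by (rule norm_triangle_ineq4)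
    also have "\<dots> \<le> M * M + M * M"
      by (intro add_mono mult_mono assms M0 norm_ge_zero)
    finally show "cmod (u0 * v1 - v0 * u1) \<le> 2 * M\<^sup>2" by (simp add: power2_eq_square)
  qed (use assms in auto)
  finally show ?thesis .
qed

context two_point_problem
begin

lemma homogenised_conditions_bounded:
  obtains M where "\<And>j \<zeta>. cmod \<zeta> \<le> 1 \<Longrightarrow>
    cmod (homogenise (P j) (ord j) \<zeta>) + cmod (homogenise (Q j) (ord j) \<zeta>) \<le> M"
proof -
  define h where "h j = (\<Sum>i\<le>ord j. cmod (coeff (P j) i)) + (\<Sum>i\<le>ord j. cmod (coeff (Q j) i))" for j
  have "cmod (homogenise (P j) (ord j) \<zeta>) + cmod (homogenise (Q j) (ord j) \<zeta>) \<le> h 0 + h 1"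
    if "cmod \<zeta> \<le> 1" for j \<zeta>
  proof -
    have "cmod (homogenise (P j) (ord j) \<zeta>) + cmod (homogenise (Q j) (ord j) \<zeta>) \<le> h j"
      unfolding h_def by (intro add_mono homogenise_bounded that)
    moreover have "h i \<ge> 0" for i
      unfolding h_def by (intro add_nonneg_nonneg sum_nonneg norm_ge_zero)
    ultimately show ?thesis
      using index_2_cases[of j] by (smt (verit))
  qed
  then show ?thesis by (rule that)
qed

lemma norm_left_right_bounded:
  assumes M: "cmod (homogenise (P j) (ord j) \<zeta>) + cmod (homogenise (Q j) (ord j) \<zeta>) \<le> M"
      "cmod (homogenise (P j) (ord j) (- \<zeta>)) + cmod (homogenise (Q j) (ord j) (- \<zeta>)) \<le> M"
    and s: "cmod s \<le> 1"
  shows "cmod (norm_left j \<zeta> s) \<le> M" "cmod (norm_right j \<zeta> s) \<le> M"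
proof -
  have *: "cmod s * cmod u \<le> cmod u" for u
    using s by (simp add: mult_left_le_one_le)
  have "cmod (norm_left j \<zeta> s) \<le> cmod (homogenise (P j) (ord j) \<zeta>)
      + cmod s * cmod (homogenise (Q j) (ord j) \<zeta>)"
    unfolding norm_left_def norm_mult[symmetric] by (rule norm_triangle_ineq)
  then show "cmod (norm_left j \<zeta> s) \<le> M"
    using *[of "homogenise (Q j) (ord j) \<zeta>"] M(1) by linarith
  have "cmod (norm_right j \<zeta> s)
      = cmod (s * homogenise (P j) (ord j) (- \<zeta>) + homogenise (Q j) (ord j) (- \<zeta>))"
    unfolding norm_right_def norm_mult by (simp add: norm_power)
  also have "\<dots> \<le> cmod s * cmod (homogenise (P j) (ord j) (- \<zeta>))
      + cmod (homogenise (Q j) (ord j) (- \<zeta>))"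
    unfolding norm_mult[symmetric] by (rule norm_triangle_ineq)
  finally show "cmod (norm_right j \<zeta> s) \<le> M"
    using *[of "homogenise (P j) (ord j) (- \<zeta>)"] M(2) by linarith
qed

lemma kernel_coeff_bounded:
  assumes z: "cmod z \<ge> 1" "Im z \<ge> 0"
    and c: "c > 0" "c \<le> cmod (norm_det (1 / (\<i> * z)) (far z))"
    and M: "\<And>j \<zeta>. cmod \<zeta> \<le> 1 \<Longrightarrow>
      cmod (homogenise (P j) (ord j) \<zeta>) + cmod (homogenise (Q j) (ord j) \<zeta>) \<le> M"
    and \<kappa>: "\<And>j. \<kappa> j = (\<i> * z) ^ ord j * \<kappa>' j" "\<And>j. cmod (\<kappa>' j) \<le> M"
  shows "cmod (kernel_coeff_left \<kappa> z) \<le> 2 * M\<^sup>2 / c" "cmod (kernel_coeff_right \<kappa> z) \<le> 2 * M\<^sup>2 / c"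
proof -
  have z0: "z \<noteq> 0" using z by auto
  have \<zeta>: "cmod (1 / (\<i> * z)) \<le> 1" "cmod (- (1 / (\<i> * z))) \<le> 1"
    using z(1) unfolding norm_minus_cancel norm_inverse_iz by (simp_all add: divide_le_eq)
  note b = norm_left_right_bounded[OF M[OF \<zeta>(1)] M[OF \<zeta>(2)] norm_far_le_1[OF z(2)]]
  have nz: "(\<i> * z) ^ n \<noteq> 0" for n using z0 by simp
  show "cmod (kernel_coeff_left \<kappa> z) \<le> 2 * M\<^sup>2 / c"
    unfolding kernel_coeff_left_def bc_right_eq[OF z0] char_det_eq[OF z0] \<kappa>(1)
    by (rule det_quotient_bounded[OF nz nz c b(2) b(2) \<kappa>(2) \<kappa>(2)])
  show "cmod (kernel_coeff_right \<kappa> z) \<le> 2 * M\<^sup>2 / c"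
    unfolding kernel_coeff_right_def bc_left_eq[OF z0] char_det_eq[OF z0] \<kappa>(1)
    by (rule det_quotient_bounded[OF nz nz c \<kappa>(2) \<kappa>(2) b(1) b(1)])
qed

text \<open>In the upper half plane the exponentials at distance at least \<open>\<rho>\<close> from the endpoint where they
  are normalised have modulus at most \<open>exp (- \<rho> * Im z)\<close>. Each of the four terms contains two of them; one is
  enough, and the other is estimated by \<open>1\<close>.\<close>

lemma boundary_kernel_bounded:
  assumes z: "cmod z \<ge> 1" "Im z \<ge> 0"
    and c: "c > 0" "c \<le> cmod (norm_det (1 / (\<i> * z)) (far z))"
    and M: "\<And>j \<zeta>. cmod \<zeta> \<le> 1 \<Longrightarrow>
      cmod (homogenise (P j) (ord j) \<zeta>) + cmod (homogenise (Q j) (ord j) \<zeta>) \<le> M"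
    and \<rho>: "0 \<le> \<rho>" "\<rho> \<le> x - a" "\<rho> \<le> b - x"
  shows "cmod (boundary_kernel z x x) \<le> 8 * M\<^sup>2 / c * exp (- (\<rho> * Im z))"
proof -
  define C where "C = 2 * M\<^sup>2 / c"
  define r where "r = exp (- (\<rho> * Im z))"
  have z0: "z \<noteq> 0" using z by auto
  have \<zeta>: "cmod (1 / (\<i> * z)) \<le> 1" "cmod (- (1 / (\<i> * z))) \<le> 1"
    using z(1) unfolding norm_minus_cancel norm_inverse_iz by (simp_all add: divide_le_eq)
  have C0: "C \<ge> 0" using c by (simp add: C_def)
  have r: "0 \<le> r" "r \<le> 1" using z \<rho> by (simp_all add: r_def)
  have \<phi>: "cmod (exp_left a z x) \<le> r" and \<psi>: "cmod (exp_right b z x) \<le> r"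
    using z(2) \<rho> by (auto simp: exp_left_def exp_right_def r_def mult_right_mono mult.commute[of "Im z"])
  have "cmod (homogenise (P j) (ord j) (- (1 / (\<i> * z)))) \<le> M"
    "cmod (homogenise (Q j) (ord j) (1 / (\<i> * z))) \<le> M" for j
    using M[OF \<zeta>(1), of j] M[OF \<zeta>(2), of j] norm_ge_zero
    by (smt (verit))+
  then have \<kappa>: "cmod ((- 1) ^ ord j * homogenise (P j) (ord j) (- (1 / (\<i> * z)))) \<le> M"
    "cmod (homogenise (Q j) (ord j) (1 / (\<i> * z))) \<le> M" for j
    unfolding norm_mult by (simp_all add: norm_power)
  note bP = kernel_coeff_bounded[OF z c M poly_at_iz(3)[OF z0] \<kappa>(1), folded C_def]
  note bQ = kernel_coeff_bounded[OF z c M poly_at_iz(2)[OF z0] \<kappa>(2), folded C_def]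
  have bound: "cmod (e * (k * f + l * g)) \<le> 2 * C * r"
    if "cmod e \<le> r" "cmod f \<le> r" "cmod g \<le> r" "cmod k \<le> C" "cmod l \<le> C" for e f g k l
  proof -
    have "cmod (k * f + l * g) \<le> cmod k * cmod f + cmod l * cmod g"
      unfolding norm_mult[symmetric] by (rule norm_triangle_ineq)
    also have "\<dots> \<le> C * 1 + C * 1"
      using that r C0 by (intro add_mono mult_mono) auto
    finally have "cmod e * cmod (k * f + l * g) \<le> r * (2 * C)"
      using that r by (intro mult_mono) auto
    then show ?thesis by (simp add: norm_mult mult_ac)
  qed
  have "cmod (boundary_kernel z x x) \<le> 2 * C * r + 2 * C * r"
    unfolding boundary_kernel_def
    by (intro norm_triangle_le add_mono bound \<phi> \<psi> bP bQ)
  then show ?thesis by (simp add: C_def r_def)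
qed

lemma continuous_on_boundary_kernel:
  fixes z :: "real \<Rightarrow> complex"
  assumes z: "continuous_on S z" and nz: "\<And>t. t \<in> S \<Longrightarrow> char_det P Q (z t) (far (z t)) \<noteq> 0"
  shows "continuous_on S (\<lambda>t. boundary_kernel (z t) x y)"
proof -
  have cs: "continuous_on S (\<lambda>t. far (z t))"
    unfolding far_def by (intro continuous_intros z)
  have cl: "continuous_on S (\<lambda>t. bc_left (P j) (Q j) (z t) (far (z t)))" for j
    unfolding bc_left_def by (intro continuous_intros z cs)
  have cr: "continuous_on S (\<lambda>t. bc_right (P j) (Q j) (z t) (far (z t)))" for j
    unfolding bc_right_def by (intro continuous_intros z cs)
  have cd: "continuous_on S (\<lambda>t. char_det P Q (z t) (far (z t)))"
    unfolding char_det_def by (intro continuous_intros cl cr)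
  have ck: "continuous_on S (\<lambda>t. kernel_coeff_left (\<kappa> t) (z t))"
    "continuous_on S (\<lambda>t. kernel_coeff_right (\<kappa> t) (z t))"
    if "\<And>j. continuous_on S (\<lambda>t. \<kappa> t j)" for \<kappa>
    unfolding kernel_coeff_left_def kernel_coeff_right_def
    by (intro continuous_on_divide continuous_on_diff continuous_on_mult that cl cr cd ballI nz;
        assumption)+
  have ce: "continuous_on S (\<lambda>t. exp_left a (z t) u)" "continuous_on S (\<lambda>t. exp_right b (z t) u)" for u
    unfolding exp_left_def exp_right_def by (intro continuous_intros z)+
  show ?thesis
    unfolding boundary_kernel_def
    by (intro continuous_on_add continuous_on_mult ce ck continuous_on_poly continuous_on_minus
        continuous_on_const z)
qed

end

section \<open>The limit of the contour integrals\<close>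

text \<open>Parametrising the circle by \<open>\<mu> = z\<^sup>2\<close> with \<open>z = R * exp (\<i> * pi * t)\<close>, \<open>0 < t < 1\<close>, keeps \<open>z\<close>
  in the upper half plane and turns \<open>d\<mu>\<close> into \<open>2 * pi * \<i> * z\<^sup>2 dt\<close>, which cancels the factor
  \<open>1 / z\<^sup>2\<close> of \<open>(G \<mu>)\<^sup>2\<close>. The endpoints, where \<open>Im z = 0\<close> and \<open>E\<close> does not decay, form a null
  set.\<close>

lemma circle_integral_limit:
  fixes G :: "complex \<Rightarrow> complex" and E :: "complex \<Rightarrow> complex"
  assumes R: "filterlim R at_top sequentially" and R1: "\<And>l. R l \<ge> 1"
    and G: "\<And>l z. cmod z = R l \<Longrightarrow> Im z \<ge> 0 \<Longrightarrow> G (z\<^sup>2) = \<i> / (2 * z) * (1 + E z)"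
    and E: "\<And>l z. cmod z = R l \<Longrightarrow> Im z \<ge> 0 \<Longrightarrow> cmod (E z) \<le> B * exp (- (\<rho> * Im z))"
    and contE: "\<And>l. continuous_on {0..1} (\<lambda>t. E (of_real (R l) * exp (\<i> * of_real (pi * t))))"
    and \<rho>: "\<rho> > 0"
  shows "(\<lambda>l. contour_integral (circlepath 0 ((R l)\<^sup>2)) (\<lambda>\<mu>. (G \<mu>)\<^sup>2)) \<longlonglongrightarrow> - (complex_of_real pi * \<i> / 2)"
proof -
  define z where "z l t = of_real (R l) * exp (\<i> * of_real (pi * t))" for l t
  define f where "f l t = - (complex_of_real pi * \<i> / 2) * (1 + E (z l t))\<^sup>2" for l t
  have cmod_z: "cmod (z l t) = R l" for l t
    using R1[of l] by (simp add: z_def norm_mult)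
  have Im_z: "Im (z l t) = R l * sin (pi * t)" for l t
    by (simp add: z_def Im_exp)
  have sin_pos: "sin (pi * t) > 0" if "t \<in> {0<..<1}" for t
    using that by (intro sin_gt_zero) auto
  have Im_nonneg: "Im (z l t) \<ge> 0" if "t \<in> {0<..<1}" for l t
    using sin_pos[OF that] R1[of l] by (simp add: Im_z)
  have "B \<ge> 0"
  proof -
    have "0 \<le> cmod (E (z 0 (1/2)))" by (rule norm_ge_zero)
    also have "\<dots> \<le> B * exp (- (\<rho> * Im (z 0 (1/2))))"
      by (rule E[OF cmod_z Im_nonneg]) simp
    finally show ?thesis by (simp add: zero_le_mult_iff)
  qed
  have integral_eq: "contour_integral (circlepath 0 ((R l)\<^sup>2)) (\<lambda>\<mu>. (G \<mu>)\<^sup>2) = integral {0<..<1} (f l)" for l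
  proof -
    have "contour_integral (circlepath 0 ((R l)\<^sup>2)) (\<lambda>\<mu>. (G \<mu>)\<^sup>2)
        = integral {0<..<1} (\<lambda>t. (G (circlepath 0 ((R l)\<^sup>2) t))\<^sup>2
            * vector_derivative (circlepath 0 ((R l)\<^sup>2)) (at t))"
      unfolding contour_integral_integral by (rule integral_open_interval_real)
    also have "\<dots> = integral {0<..<1} (f l)"
    proof (rule integral_cong)
      fix t :: real assume t: "t \<in> {0<..<1}"
      have z0: "z l t \<noteq> 0" using cmod_z[of l t] R1[of l] by auto
      have sq: "of_real ((R l)\<^sup>2) * exp (2 * of_real pi * \<i> * of_real t) = (z l t)\<^sup>2"
        by (simp add: z_def power_mult_distrib exp_double[symmetric] mult_ac)
      have c: "circlepath 0 ((R l)\<^sup>2) t = (z l t)\<^sup>2"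
        unfolding sq[symmetric] by (simp add: circlepath)
      have d: "vector_derivative (circlepath 0 ((R l)\<^sup>2)) (at t) = 2 * of_real pi * \<i> * (z l t)\<^sup>2"
        unfolding sq[symmetric] by (simp add: vector_derivative_circlepath)
      show "(G (circlepath 0 ((R l)\<^sup>2) t))\<^sup>2 * vector_derivative (circlepath 0 ((R l)\<^sup>2)) (at t) = f l t"
        unfolding c d G[OF cmod_z Im_nonneg[OF t]] f_def using z0
        by (simp add: power_mult_distrib power_divide)
    qed
    finally show ?thesis .
  qed
  have "(\<lambda>l. integral {0<..<1} (f l)) \<longlonglongrightarrow> integral {0<..<1::real} (\<lambda>_. - (complex_of_real pi * \<i> / 2))"
  proof (rule dominated_convergence(2))
    show "f l integrable_on {0<..<1}" for l
      unfolding integrable_on_open_interval_real f_def[abs_def] z_def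
      by (intro integrable_continuous_real continuous_on_mult continuous_on_power continuous_on_add
          continuous_on_const contE)
    show "(\<lambda>_. pi / 2 * (1 + B)\<^sup>2) integrable_on {0<..<1::real}"
      unfolding integrable_on_open_interval_real by (rule integrable_const_ivl)
    show "norm (f l t) \<le> pi / 2 * (1 + B)\<^sup>2" if t: "t \<in> {0<..<1}" for l t
    proof -
      have "cmod (E (z l t)) \<le> B * exp (- (\<rho> * Im (z l t)))"
        by (rule E[OF cmod_z Im_nonneg[OF t]])
      also have "\<dots> \<le> B"
        using \<open>B \<ge> 0\<close> \<rho> Im_nonneg[OF t] by (intro mult_left_le) auto
      finally have "cmod (1 + E (z l t)) \<le> 1 + B"
        using norm_triangle_ineq[of 1 "E (z l t)"] by simp
      then have "(cmod (1 + E (z l t)))\<^sup>2 \<le> (1 + B)\<^sup>2"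
        by (intro power_mono) auto
      then show ?thesis
        by (simp add: f_def norm_mult norm_power norm_divide)
    qed
    show "(\<lambda>l. f l t) \<longlonglongrightarrow> - (complex_of_real pi * \<i> / 2)" if t: "t \<in> {0<..<1}" for t
    proof -
      have "(\<lambda>l. E (z l t)) \<longlonglongrightarrow> 0"
      proof (rule Lim_null_comparison[OF always_eventually])
        show "\<forall>l. norm (E (z l t)) \<le> B * exp (- ((\<rho> * sin (pi * t)) * R l))"
          using E[OF cmod_z Im_nonneg[OF t]] by (simp add: Im_z mult_ac)
        have "filterlim (\<lambda>l. (\<rho> * sin (pi * t)) * R l) at_top sequentially"
          using sin_pos[OF t] \<rho> R by (intro filterlim_tendsto_pos_mult_at_top[OF tendsto_const]) auto
        then have "(\<lambda>l. exp (- ((\<rho> * sin (pi * t)) * R l))) \<longlonglongrightarrow> 0"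
          by (intro filterlim_compose[OF exp_at_bot] filterlim_compose[OF filterlim_uminus_at_bot_at_top])
        then show "(\<lambda>l. B * exp (- ((\<rho> * sin (pi * t)) * R l))) \<longlonglongrightarrow> 0"
          by (rule tendsto_mult_right_zero)
      qed
      then have "(\<lambda>l. f l t) \<longlonglongrightarrow> - (complex_of_real pi * \<i> / 2) * (1 + 0)\<^sup>2"
        unfolding f_def by (intro tendsto_intros)
      then show ?thesis by simp
    qed
  qed
  then show ?thesis
    unfolding integral_eq by (simp flip: integral_open_interval_real)
qed

theorem theorem2p5:
  fixes a b x :: real
    and P Q :: "2 \<Rightarrow> complex poly"
    and G\<^sub>0 :: "real \<Rightarrow> real \<Rightarrow> complex \<Rightarrow> complex"
    and R :: "nat \<Rightarrow> real"
  assumes "a < b"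
    and "\<And>j. degree (P j) \<le> 1"
    and "\<And>j. degree (Q j) \<le> 1"
    and "\<And>j. lead_a P Q j \<noteq> 0 \<or> lead_b P Q j \<noteq> 0"
    and "normalized_bc P Q"
    and "birkhoff_regular P Q"
    and "is_green_function a b P Q G\<^sub>0"
    and "x \<in> {a..b}" and "x \<noteq> a" and "x \<noteq> b"
    and "filterlim R at_top sequentially"
    and "separated_from R ((\<lambda>\<mu>. sqrt (cmod \<mu>)) ` L0_eigenvalues a b P Q)"
  shows "(\<lambda>l. contour_integral (circlepath 0 ((R l)\<^sup>2)) (\<lambda>\<mu>. (G\<^sub>0 x x \<mu>)\<^sup>2))
           \<longlonglongrightarrow> - (complex_of_real pi * \<i> / 2)"
proof -
  interpret two_point_problem a b P Q
    by unfold_locales (use assms in auto)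
  obtain \<delta> where "\<delta> > 0"
    and sep: "\<And>l \<mu>. \<mu> \<in> L0_eigenvalues a b P Q \<Longrightarrow> \<delta> \<le> \<bar>R l - sqrt (cmod \<mu>)\<bar>"
    using assms(12) unfolding separated_from_def by blast
  have sep2: "w\<^sup>2 \<notin> L0_eigenvalues a b P Q" if "\<bar>R l - cmod w\<bar> < \<delta>" for l w
    using sep[of "w\<^sup>2" l] that by (auto simp: norm_power)
  have zero_free: "char_det P Q w (far w) \<noteq> 0" if "w \<noteq> 0" "\<bar>R l - cmod w\<bar> < \<delta>" for l w
    using square_is_eigenvalue_if_char_det_zero[of a b P Q w, OF ab deg that(1)] sep2[OF that(2)]
    unfolding far_def by blast
  have norm_zero_free: "norm_det (1 / (\<i> * w)) (far w) \<noteq> 0" if "w \<noteq> 0" "\<bar>R l - cmod w\<bar> < \<delta>" for l w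
    using zero_free[OF that] char_det_eq[OF that(1), of "far w"] by auto
  obtain c L where "c > 0" and
    c: "\<And>l z. l \<ge> L \<Longrightarrow> cmod z = R l \<Longrightarrow> Im z \<ge> 0 \<Longrightarrow> c \<le> cmod (norm_det (1 / (\<i> * z)) (far z))"
  proof (rule norm_det_bounded_below[OF assms(6) \<open>\<delta> > 0\<close> assms(11)])
    show "norm_det (1 / (\<i> * w)) (far w) \<noteq> 0" if "w \<noteq> 0" "\<bar>R l - cmod w\<bar> < \<delta>" for l w
      using that by (rule norm_zero_free)
  qed blast
  obtain M where M: "\<And>j \<zeta>. cmod \<zeta> \<le> 1 \<Longrightarrow>
    cmod (homogenise (P j) (bc_order P Q j) \<zeta>) + cmod (homogenise (Q j) (bc_order P Q j) \<zeta>) \<le> M"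
    using homogenised_conditions_bounded by blast
  obtain L' where L': "\<And>l. l \<ge> L' \<Longrightarrow> R l \<ge> 1"
    using assms(11) by (auto simp: filterlim_at_top eventually_sequentially)
  \<comment> \<open>From index \<open>N\<close> on both the lower bound for the determinant and \<open>R \<ge> 1\<close> hold.\<close>
  define N where "N = L + L'"
  define \<rho> where "\<rho> = min (x - a) (b - x)"
  have \<rho>: "\<rho> > 0" "\<rho> \<le> x - a" "\<rho> \<le> b - x"
    using assms(8-10) by (auto simp: \<rho>_def)
  have R1: "R (l + N) \<ge> 1" for l using L' by (simp add: N_def)
  have "(\<lambda>l. contour_integral (circlepath 0 ((R (l + N))\<^sup>2)) (\<lambda>\<mu>. (G\<^sub>0 x x \<mu>)\<^sup>2))
      \<longlonglongrightarrow> - (complex_of_real pi * \<i> / 2)"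
  proof (rule circle_integral_limit)
    show "filterlim (\<lambda>l. R (l + N)) at_top sequentially"
      by (rule filterlim_compose[OF assms(11) filterlim_add_const_nat_at_top])
    show "R (l + N) \<ge> 1" for l by (rule R1)
    fix l
    have on_circle: "z \<noteq> 0" "cmod z \<ge> 1" "char_det P Q z (far z) \<noteq> 0" "z\<^sup>2 \<notin> L0_eigenvalues a b P Q"
      if "cmod z = R (l + N)" for z
    proof -
      show "z \<noteq> 0" "cmod z \<ge> 1" using that R1[of l] by auto
      then show "char_det P Q z (far z) \<noteq> 0" "z\<^sup>2 \<notin> L0_eigenvalues a b P Q"
        using zero_free[of z "l + N"] sep2[of "l + N" z] that \<open>\<delta> > 0\<close> by auto
    qed
    show "G\<^sub>0 x x (z\<^sup>2) = \<i> / (2 * z) * (1 + boundary_kernel z x x)"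
      if "cmod z = R (l + N)" "Im z \<ge> 0" for z
    proof -
      have "is_resolvent_kernel a b P Q (z\<^sup>2) (\<lambda>x y. G\<^sub>0 x y (z\<^sup>2))"
        using assms(7) on_circle(4)[OF that(1)] unfolding is_green_function_def by blast
      from resolvent_kernel_eq_green_kernel[OF this on_circle(1,3)[OF that(1)] assms(8) assms(8)]
      show ?thesis by (simp add: green_kernel_def)
    qed
    show "cmod (boundary_kernel z x x) \<le> 8 * M\<^sup>2 / c * exp (- (\<rho> * Im z))"
      if "cmod z = R (l + N)" "Im z \<ge> 0" for z
      using c[of "l + N" z] that \<rho>
      by (intro boundary_kernel_bounded on_circle(2) \<open>c > 0\<close> M) (auto simp: N_def)
    show "continuous_on {0..1}
        (\<lambda>t. boundary_kernel (of_real (R (l + N)) * exp (\<i> * of_real (pi * t))) x x)"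
      using R1[of l]
      by (intro continuous_on_boundary_kernel on_circle(3) continuous_intros) (simp add: norm_mult)
  qed (fact \<rho>(1))
  then show ?thesis by (rule LIMSEQ_offset)
qed

end
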